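(* Let $K$ be a quadratic field and $c \in K$. Then the directed graph $G(f_c,K)$ does not contain a subgraph isomorphic to the graph $G_1$.
   Context: For $f_c(z) = z^2 + c$ and a number field $K$, $G(f_c,K)$ is the directed graph whose vertices are the points of $K$ (the point at infinity excluded) that are preperiodic for $f_c$ (i.e. $f_c^{m+n}(x) = f_c^n(x)$ for some $m \ge 1$, $n \ge 0$), with an edge $x \to y$ iff $f_c(x) = y$. The graph $G_1$ has ten vertices $a, a', b, b', p, \bar p, s, \bar s, r, \bar r$ and edges $a \to a$, $b \to a$, $a' \to a'$, $b' \to a'$, $p \to b$, $\bar p \to b$, $s \to b'$, $\bar s \to b'$, $r \to p$, $\bar r \to p$ (equivalently: two distinct fixed points, a point $r$ of preperiodic type $1_3$, i.e. preperiod $3$ and eventual period $1$, and a point $s$ of type $1_2$ whose orbit is disjoint from that of $r$, together with the additional preimages these force). *)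

theory Defs
  imports Complex_Main "Graph_Theory.Graph_Theory"
begin

text \<open>Fields are given as subfields of an arbitrary ambient field of characteristic 0. Taking
  the ambient field to be the field itself covers every abstract number field, and taking it
  to be the complex numbers covers every embedded one.\<close>

definition subfield_set :: "'a::field set \<Rightarrow> bool" where
  "subfield_set K \<longleftrightarrow> 1 \<in> K \<and> (\<forall>x\<in>K. \<forall>y\<in>K. x - y \<in> K \<and> x * y \<in> K) \<and> (\<forall>x\<in>K. inverse x \<in> K)"

definition rat_scale :: "rat \<Rightarrow> 'a::field_char_0 \<Rightarrow> 'a" where
  "rat_scale q x = of_rat q * x"

lemma vector_space_rat_scale: "vector_space (rat_scale :: rat \<Rightarrow> 'a::field_char_0 \<Rightarrow> 'a)"
  by standard (simp_all add: rat_scale_def algebra_simps of_rat_add of_rat_mult)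

text \<open>The library's dimension is 0 for infinite-dimensional spaces, so dimension 2 really means
  a basis with two elements.\<close>

definition quadratic_field :: "'a::field_char_0 set \<Rightarrow> bool" where
  "quadratic_field K \<longleftrightarrow> subfield_set K \<and> vector_space.dim rat_scale K = 2"

definition quad_map :: "'a::field \<Rightarrow> 'a \<Rightarrow> 'a" where
  "quad_map c z = z ^ 2 + c"

definition preperiodic :: "('a \<Rightarrow> 'a) \<Rightarrow> 'a \<Rightarrow> bool" where
  "preperiodic f x \<longleftrightarrow> (\<exists>m n. m \<ge> 1 \<and> (f ^^ (m + n)) x = (f ^^ n) x)"

definition preper_graph :: "'a::field \<Rightarrow> 'a set \<Rightarrow> 'a pair_pre_digraph" where
  "preper_graph c K =
     (let V = {x \<in> K. preperiodic (quad_map c) x}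
      in \<lparr>pverts = V, parcs = {(x, y). x \<in> V \<and> y \<in> V \<and> quad_map c x = y}\<rparr>)"

text \<open>The library's notion of subgraph includes well-formedness of both graphs.\<close>

lemma pair_wf_preper_graph: "pair_wf_digraph (preper_graph c K)"
  by unfold_locales (auto simp: preper_graph_def Let_def)

datatype G1_vertex =
  v_a | v_a' | v_b | v_b' | v_p | v_pbar | v_s | v_sbar | v_r | v_rbar

definition G1 :: "G1_vertex pair_pre_digraph" where
  "G1 = \<lparr>pverts = UNIV,
         parcs = {(v_a, v_a), (v_b, v_a), (v_a', v_a'), (v_b', v_a'), (v_p, v_b), (v_pbar, v_b),
                  (v_s, v_b'), (v_sbar, v_b'), (v_r, v_p), (v_rbar, v_p)}\<rparr>"

lemma pair_wf_G1: "pair_wf_digraph G1"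
  by unfold_locales (auto simp: G1_def)

definition contains_isomorphic_subgraph :: "('a, 'b) pre_digraph \<Rightarrow> ('c, 'd) pre_digraph \<Rightarrow> bool" where
  "contains_isomorphic_subgraph G F \<longleftrightarrow> (\<exists>H. subgraph H G \<and> digraph_iso F H)"

end

theory Submission
  imports Defs "HOL-Computational_Algebra.Nth_Powers"
begin

text \<open>If \<open>a\<close>, \<open>a'\<close> are the two fixed points and \<open>p\<close>, \<open>r\<close>, \<open>s\<close> are the labelled vertices of \<open>G\<^sub>1\<close>, then
  \<open>t = a - 1 + p\<close>, \<open>y = 2 t r\<close>, \<open>z = 2 t s\<close> satisfy \<open>y\<^sup>2 = t\<^sup>4 + 4 t\<^sup>3 + 2 t\<^sup>2 + 1\<close> and
  \<open>z\<^sup>2 = t\<^sup>4 + 4 t\<^sup>3 + 2 t\<^sup>2 + 4 t + 1\<close>, with \<open>t \<noteq> 0, -1\<close>. Call the two genus one curves \<open>E\<^sub>1\<close> (which is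
  \<open>X\<^sub>1(11)\<close>) and \<open>E\<^sub>2\<close>. Both have finitely many rational points, all with \<open>t \<in> {0, -1, \<infinity>}\<close>.

  If \<open>t\<close> is irrational of degree two, its minimal polynomial belongs to one of finitely many pencils
  attached to the rational points of \<open>E\<^sub>1\<close>, and likewise for \<open>E\<^sub>2\<close>; no two of these pencils share a
  polynomial over the rationals. If \<open>t\<close> is rational, then either \<open>y\<close> or \<open>z\<close> is rational, or the two right
  hand sides have the same square class. In the last case they share only the prime 2, so up to sign
  the second one is a square, that is, \<open>t\<close> lies on \<open>E\<^sub>2\<close> or its twist by \<open>-1\<close>.

  The curve \<open>E\<^sub>2\<close> and its twist are settled by Fermat's descent for \<open>x\<^sup>4 \<plusminus> x\<^sup>2 y\<^sup>2 + y\<^sup>4\<close>. The curve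
  \<open>E\<^sub>1\<close> has no rational 2-torsion; here the 2-descent is done with binary quartic forms of
  invariants 16 and -304: reduction theory shows that there is only one class of such forms.\<close>

section \<open>Descents for \<open>x\<^sup>4 \<plusminus> x\<^sup>2 y\<^sup>2 + y\<^sup>4\<close>\<close>

lemma coprime_mult_eq_square_int:
  fixes a b c :: int
  assumes "coprime a b" and "a * b = c\<^sup>2"
  obtains x where "\<bar>a\<bar> = x\<^sup>2"
proof -
  have eq: "nat \<bar>a\<bar> * nat \<bar>b\<bar> = nat \<bar>c\<bar> ^ 2"
    by (metis assms(2) abs_mult nat_abs_mult_distrib power2_eq_square)
  have "is_square (nat \<bar>a\<bar>)"
  proof (cases "a = 0 \<or> b = 0")
    case True
    then have "\<bar>a\<bar> = 0 \<or> \<bar>a\<bar> = 1" using assms(1) by auto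
    then show ?thesis by auto
  next
    case False
    have "coprime (nat \<bar>a\<bar>) (nat \<bar>b\<bar>)" using assms(1) by simp
    moreover have "is_square (nat \<bar>a\<bar> * nat \<bar>b\<bar>)" unfolding eq by simp
    ultimately show ?thesis
      using False is_nth_power_mult_coprime_natD(1)[of "nat \<bar>a\<bar>" "nat \<bar>b\<bar>" 2] by simp
  qed
  then obtain x where "nat \<bar>a\<bar> = x ^ 2"
    by (auto simp: is_nth_power_def)
  then have "\<bar>a\<bar> = (int x)\<^sup>2"
    by (metis abs_ge_zero int_nat_eq of_nat_power)
  then show ?thesis using that by blast
qed

lemma four_numbers:
  fixes a b c d :: int
  assumes "a * b = c * d" and "a \<noteq> 0"
  obtains p q r s where "a = p * q" "b = r * s" "c = p * r" "d = q * s"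
proof -
  define p where "p = gcd a c"
  have p: "p \<noteq> 0" using assms(2) by (simp add: p_def)
  obtain q where q: "a = p * q" using p_def by (meson dvdE gcd_dvd1)
  obtain r where r: "c = p * r" using p_def by (meson dvdE gcd_dvd2)
  have "coprime q r"
    using p q r p_def by (metis gcd_coprime mult.commute nonzero_mult_div_cancel_left div_gcd_coprime assms(2))
  have "q * b = r * d" using assms(1) p q r by simp
  then have "q dvd d" using \<open>coprime q r\<close>
    by (metis coprime_dvd_mult_right_iff dvd_triv_left)
  then obtain s where s: "d = q * s" by blast
  have "q \<noteq> 0" using q assms(2) by auto
  then have "b = r * s" using \<open>q * b = r * d\<close> s by simp
  with q r s that show ?thesis by blast
qed

lemma primitive_pythagorean:
  fixes u v w :: int
  assumes uv: "coprime u v" and "even v" and eq: "u\<^sup>2 + v\<^sup>2 = w\<^sup>2"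
  obtains r s where "coprime r s" "u = r\<^sup>2 - s\<^sup>2" "v = 2 * r * s" "\<bar>w\<bar> = r\<^sup>2 + s\<^sup>2"
proof -
  have "odd u" using uv \<open>even v\<close> by (metis coprime_common_divisor odd_one)
  then have "odd (u\<^sup>2 + v\<^sup>2)" using \<open>even v\<close> by simp
  then have "odd w" using eq by simp
  define W where "W = \<bar>w\<bar>"
  have "odd W" using \<open>odd w\<close> by (simp add: W_def)
  have W2: "u\<^sup>2 + v\<^sup>2 = W\<^sup>2" using eq by (simp add: W_def)
  obtain A where A: "W + u = 2 * A" using \<open>odd u\<close> \<open>odd W\<close> by (metis odd_even_add dvdE)
  obtain B where B: "W - u = 2 * B" using \<open>odd u\<close> \<open>odd W\<close> by (metis even_diff odd_even_add dvdE)
  obtain V where V: "v = 2 * V" using \<open>even v\<close> by blast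
  have u: "u = A - B" and Wab: "W = A + B" using A B by auto
  have "4 * (A * B) = 4 * V\<^sup>2"
    using W2 unfolding u Wab V by (simp add: algebra_simps power2_eq_square)
  then have AB: "A * B = V\<^sup>2" by simp
  have "coprime A B"
  proof (rule coprimeI)
    fix c assume c: "c dvd A" "c dvd B"
    then have "c dvd u" by (simp add: u)
    have "c\<^sup>2 dvd V\<^sup>2" using c AB by (metis mult_dvd_mono power2_eq_square)
    then have "c dvd V" by simp
    then have "c dvd v" by (simp add: V)
    with \<open>c dvd u\<close> uv show "is_unit c" by (metis coprime_common_divisor)
  qed
  have le: "\<bar>u\<bar> \<le> W"
    using W2 by (metis W_def abs_ge_zero abs_le_square_iff abs_abs le_add_same_cancel1 zero_le_power2)
  then have "A \<ge> 0" "B \<ge> 0" using A B by auto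
  obtain r where r: "A = r\<^sup>2"
    using coprime_mult_eq_square_int[OF \<open>coprime A B\<close> AB] \<open>A \<ge> 0\<close> by auto
  obtain s where s: "B = s\<^sup>2"
    using coprime_mult_eq_square_int[of B A V] \<open>coprime A B\<close> AB \<open>B \<ge> 0\<close>
    by (metis abs_of_nonneg coprime_commute mult.commute)
  have "(r * s)\<^sup>2 = V\<^sup>2" using AB r s by (simp add: power_mult_distrib)
  then consider "r * s = V" | "r * s = - V" by (auto simp: power2_eq_iff)
  moreover have rs: "coprime r s" using \<open>coprime A B\<close> r s by simp
  ultimately show ?thesis
  proof cases
    case 1
    then show ?thesis using that[of r s] rs u r s V Wab W_def by (simp add: algebra_simps)
  next
    case 2
    then show ?thesis using that[of r "- s"] rs u r s V Wab W_def by (simp add: algebra_simps)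
  qed
qed

lemma square_mod_4_int: "(x::int)\<^sup>2 mod 4 = (if even x then 0 else 1)"
proof (cases "even x")
  case True
  then obtain k where "x = 2 * k" by blast
  then show ?thesis by (simp add: power2_eq_square)
next
  case False
  then obtain k where "x = 2 * k + 1" by (rule oddE)
  then have "x\<^sup>2 = 4 * (k\<^sup>2 + k) + 1" by (simp add: power2_eq_square algebra_simps)
  then show ?thesis using False by presburger
qed

lemma odd_square_mod_8_int: "odd (x::int) \<Longrightarrow> x\<^sup>2 mod 8 = 1"
proof -
  assume "odd x"
  then obtain k where k: "x = 2 * k + 1" by (rule oddE)
  have "even (k\<^sup>2 + k)" by simp
  then obtain l where "k\<^sup>2 + k = 2 * l" by blast
  then have "x\<^sup>2 = 8 * l + 1" using k by (simp add: power2_eq_square algebra_simps)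
  then show ?thesis by presburger
qed

lemma proportional_coprime_squares:
  fixes \<alpha> \<beta> \<gamma> \<delta> :: int
  assumes eq: "\<alpha>\<^sup>2 * x = \<delta>\<^sup>2 * y" and "coprime \<alpha> \<delta>" and "\<alpha> \<noteq> 0"
  obtains \<kappa> where "y = \<alpha>\<^sup>2 * \<kappa>" "x = \<delta>\<^sup>2 * \<kappa>"
proof -
  have "coprime (\<alpha>\<^sup>2) (\<delta>\<^sup>2)" using assms(2) by simp
  then have "\<alpha>\<^sup>2 dvd y" using eq by (metis coprime_dvd_mult_right_iff dvd_triv_left)
  then obtain \<kappa> where k: "y = \<alpha>\<^sup>2 * \<kappa>" by blast
  with eq have "\<alpha>\<^sup>2 * x = \<alpha>\<^sup>2 * (\<delta>\<^sup>2 * \<kappa>)" by simp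
  with \<open>\<alpha> \<noteq> 0\<close> have "x = \<delta>\<^sup>2 * \<kappa>" by simp
  with k that show ?thesis by blast
qed

lemma dvd_three_int:
  fixes k :: int
  assumes "coprime b c" "k dvd 3 * b\<^sup>2" "k dvd 3 * c\<^sup>2"
  shows "k \<in> {1, -1, 3, -3}"
proof -
  have "k dvd gcd (3 * b\<^sup>2) (3 * c\<^sup>2)" using assms by simp
  also have "gcd (3 * b\<^sup>2) (3 * c\<^sup>2) = 3"
    using assms(1) by (simp add: gcd_mult_distrib_int[symmetric] coprime_iff_gcd_eq_1[symmetric])
  finally have "k dvd 3" .
  then have "\<bar>k\<bar> \<le> 3" "k \<noteq> 0" using dvd_imp_le_int[of 3 k] by auto
  then have "k \<in> {-3, -2, -1, 1, 2, 3}" by auto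
  with \<open>k dvd 3\<close> show ?thesis by auto
qed

lemma coprime_add_mult:
  fixes m n :: int
  assumes "coprime m n"
  shows "coprime (m + n) (m * n)"
proof -
  have "gcd (m + n) n = 1" "gcd (n + m) m = 1"
    unfolding gcd_add1 using assms by (simp_all add: gcd.commute)
  then have "coprime (m + n) n" "coprime (m + n) m" by (simp_all add: coprime_iff_gcd_eq_1 add.commute)
  then show ?thesis by simp
qed

lemma coprime_sum_squares:
  fixes x y :: int
  assumes "coprime x y"
  shows "coprime (x\<^sup>2 + y\<^sup>2) (x * y)"
proof -
  have "coprime (x\<^sup>2 + y\<^sup>2) (x\<^sup>2 * y\<^sup>2)" using assms by (intro coprime_add_mult) simp
  then show ?thesis by simp
qed

lemma coprime_diff_squares:
  fixes x y :: int
  assumes "coprime x y"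
  shows "coprime (x\<^sup>2 - y\<^sup>2) (x * y)"
proof -
  have "coprime (x\<^sup>2 + - y\<^sup>2) (x\<^sup>2 * - y\<^sup>2)" using assms by (intro coprime_add_mult) simp
  then show ?thesis by simp
qed

lemma one_le_abs_int: "(x::int) \<noteq> 0 \<Longrightarrow> 1 \<le> \<bar>x\<bar>"
  by linarith

lemma quartic_minus_descent_even:
  fixes x y z :: int
  assumes xy: "coprime x y" and ev: "even x" and eq: "x^4 - x\<^sup>2 * y\<^sup>2 + y^4 = z\<^sup>2" and nz: "x * y \<noteq> 0"
  obtains x' y' z' :: int where "coprime x' y'" "x' * y' \<noteq> 0" "x'\<^sup>2 \<noteq> y'\<^sup>2"
    "x'^4 - x'\<^sup>2 * y'\<^sup>2 + y'^4 = z'\<^sup>2" "\<bar>z'\<bar> < \<bar>z\<bar>"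
proof -
  have "odd y" using xy ev by (metis coprime_common_divisor odd_one)
  have eq': "(x\<^sup>2 - y\<^sup>2)\<^sup>2 + (x * y)\<^sup>2 = z\<^sup>2" using eq by (simp add: power2_eq_square power4_eq_xxxx algebra_simps)
  have "coprime (x\<^sup>2 - y\<^sup>2) (x * y)" using xy by (rule coprime_diff_squares)
  then obtain r s where rs: "coprime r s" "x\<^sup>2 - y\<^sup>2 = r\<^sup>2 - s\<^sup>2" "x * y = 2 * r * s"
    using primitive_pythagorean[OF _ _ eq'] ev by (metis even_mult_iff)
  obtain X where X: "x = 2 * X" using ev by blast
  have "X * y = r * s" "X \<noteq> 0" using rs(3) X nz by auto
  then obtain \<alpha> \<beta> \<gamma> \<delta> where f: "X = \<alpha> * \<beta>" "y = \<gamma> * \<delta>" "r = \<alpha> * \<gamma>" "s = \<beta> * \<delta>"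
    by (rule four_numbers)
  have nz': "\<alpha> \<noteq> 0" "\<beta> \<noteq> 0" "\<gamma> \<noteq> 0" "\<delta> \<noteq> 0" using nz X f by auto
  have cop: "coprime \<alpha> \<delta>" "coprime \<beta> \<gamma>" using xy X f by auto
  have "\<alpha>\<^sup>2 * (4 * \<beta>\<^sup>2 - \<gamma>\<^sup>2) = \<delta>\<^sup>2 * (\<gamma>\<^sup>2 - \<beta>\<^sup>2)"
    using rs(2) unfolding X f by (simp add: power2_eq_square algebra_simps)
  then obtain \<kappa> where k: "\<gamma>\<^sup>2 - \<beta>\<^sup>2 = \<alpha>\<^sup>2 * \<kappa>" "4 * \<beta>\<^sup>2 - \<gamma>\<^sup>2 = \<delta>\<^sup>2 * \<kappa>"
    using proportional_coprime_squares cop nz' by metis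
  have k3: "3 * \<beta>\<^sup>2 = \<kappa> * (\<alpha>\<^sup>2 + \<delta>\<^sup>2)" "3 * \<gamma>\<^sup>2 = \<kappa> * (4 * \<alpha>\<^sup>2 + \<delta>\<^sup>2)"
    using k by (auto simp: algebra_simps)
  have "\<kappa> \<in> {1, -1, 3, -3}"
    using dvd_three_int[OF cop(2), of \<kappa>] k3 by (metis dvd_triv_left)
  moreover have "\<kappa> > 0"
    using k3(1) nz' by (smt (verit) zero_less_power2 zero_less_mult_iff)
  moreover have "\<kappa> \<noteq> 1"
  proof
    assume "\<kappa> = 1"
    with k have "\<delta>\<^sup>2 + \<gamma>\<^sup>2 = 4 * \<beta>\<^sup>2" by simp
    moreover have "odd \<gamma>" "odd \<delta>" using \<open>odd y\<close> f by auto
    ultimately show False using square_mod_4_int[of \<gamma>] square_mod_4_int[of \<delta>] by presburger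
  qed
  ultimately have "\<kappa> = 3" by auto
  with k3 have bg: "\<beta>\<^sup>2 = \<alpha>\<^sup>2 + \<delta>\<^sup>2" "\<gamma>\<^sup>2 = 4 * \<alpha>\<^sup>2 + \<delta>\<^sup>2" by auto
  have "odd \<delta>" using \<open>odd y\<close> f by auto
  have "even \<alpha>"
    using bg(1) square_mod_4_int[of \<alpha>] square_mod_4_int[of \<beta>] square_mod_4_int[of \<delta>] \<open>odd \<delta>\<close>
    by presburger
  have "coprime \<delta> \<alpha>" "\<delta>\<^sup>2 + \<alpha>\<^sup>2 = \<beta>\<^sup>2" using cop(1) bg(1) by (simp_all add: coprime_commute)
  then obtain a b where ab: "coprime a b" "\<delta> = a\<^sup>2 - b\<^sup>2" "\<alpha> = 2 * a * b"
    using primitive_pythagorean \<open>even \<alpha>\<close> by metis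
  have "odd (a + b)" using \<open>odd \<delta>\<close> ab(2) by auto
  have "coprime (a + b) (a - b)"
  proof (rule coprimeI)
    fix c assume c: "c dvd a + b" "c dvd a - b"
    then have "odd c" using \<open>odd (a + b)\<close> by (metis dvd_trans)
    have "c dvd 2 * a" "c dvd 2 * b" using dvd_add[OF c] dvd_diff[OF c] by simp_all
    then have "c dvd a" "c dvd b" using \<open>odd c\<close> by (auto simp: coprime_dvd_mult_right_iff)
    then show "is_unit c" using ab(1) by (metis coprime_common_divisor)
  qed
  moreover have "(a + b) * (a - b) \<noteq> 0" using nz'(4) ab(2) by (simp add: power2_eq_square square_diff_square_factored)
  moreover have "(a + b)\<^sup>2 \<noteq> (a - b)\<^sup>2" using nz'(1) ab(3) by (auto simp: power2_eq_square algebra_simps)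
  moreover have "(a + b)^4 - (a + b)\<^sup>2 * (a - b)\<^sup>2 + (a - b)^4 = \<gamma>\<^sup>2"
    unfolding bg(2) ab by (simp add: power2_eq_square power4_eq_xxxx algebra_simps)
  moreover have "\<bar>\<gamma>\<bar> < \<bar>z\<bar>"
  proof -
    have "x\<^sup>2 \<noteq> y\<^sup>2" using ev \<open>odd y\<close> by (metis even_power zero_less_numeral)
    then have "z\<^sup>2 > (x * y)\<^sup>2" using eq' by (smt (verit) zero_less_power2)
    then have "\<bar>z\<bar> > \<bar>x * y\<bar>" by (metis abs_le_square_iff not_le)
    also have "\<bar>x * y\<bar> = \<bar>x * \<delta>\<bar> * \<bar>\<gamma>\<bar>" by (simp add: f abs_mult)
    finally have "\<bar>x * \<delta>\<bar> * \<bar>\<gamma>\<bar> < \<bar>z\<bar>" .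
    moreover have "1 * \<bar>\<gamma>\<bar> \<le> \<bar>x * \<delta>\<bar> * \<bar>\<gamma>\<bar>"
      using nz nz' by (intro mult_right_mono) (simp_all add: one_le_abs_int)
    ultimately show ?thesis by linarith
  qed
  ultimately show ?thesis by (rule that)
qed

lemma quartic_minus_descent_odd:
  fixes x y z :: int
  assumes xy: "coprime x y" and ev: "odd x" "odd y" and eq: "x^4 - x\<^sup>2 * y\<^sup>2 + y^4 = z\<^sup>2" and ne: "x\<^sup>2 \<noteq> y\<^sup>2"
  obtains x' y' z' :: int where "coprime x' y'" "x' * y' \<noteq> 0" "x'\<^sup>2 \<noteq> y'\<^sup>2"
    "x'^4 - x'\<^sup>2 * y'\<^sup>2 + y'^4 = z'\<^sup>2" "\<bar>z'\<bar> < \<bar>z\<bar>"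
proof -
  obtain a where a: "x + y = 2 * a" using ev by (metis odd_even_add dvdE)
  obtain b where b: "x - y = 2 * b" using ev by (metis even_diff odd_even_add dvdE)
  have xab: "x = a + b" "y = a - b" using a b by auto
  have "coprime a b"
    using xy unfolding xab coprime_def by (meson dvd_add dvd_diff)
  have eq': "(a\<^sup>2 - b\<^sup>2)\<^sup>2 + (4 * a * b)\<^sup>2 = z\<^sup>2"
    using eq unfolding xab by (simp add: power2_eq_square power4_eq_xxxx algebra_simps)
  have ab: "a\<^sup>2 - b\<^sup>2 = x * y" unfolding xab by (simp add: power2_eq_square algebra_simps)
  have "coprime (a\<^sup>2 - b\<^sup>2) (4 * a * b)"
  proof -
    have "coprime (a\<^sup>2 - b\<^sup>2) (a * b)" using \<open>coprime a b\<close> by (rule coprime_diff_squares)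
    moreover have "coprime (a\<^sup>2 - b\<^sup>2) (2\<^sup>2)"
      unfolding ab coprime_power_right_iff using ev by simp
    ultimately have "coprime (a\<^sup>2 - b\<^sup>2) (2\<^sup>2 * (a * b))" by (simp only: coprime_mult_right_iff)
    then show ?thesis by (simp add: mult.assoc)
  qed
  then obtain r s where rs: "coprime r s" "a\<^sup>2 - b\<^sup>2 = r\<^sup>2 - s\<^sup>2" "4 * a * b = 2 * r * s" "\<bar>z\<bar> = r\<^sup>2 + s\<^sup>2"
    using primitive_pythagorean[OF _ _ eq'] by (metis even_mult_iff even_numeral)
  have "a * b \<noteq> 0" using ne unfolding xab by (auto simp: power2_eq_square algebra_simps)
  have "r * s \<noteq> 0" using rs(3) \<open>a * b \<noteq> 0\<close> by auto
  moreover have "r\<^sup>2 \<noteq> s\<^sup>2" using rs(2) ab ev by auto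
  moreover have "r^4 - r\<^sup>2 * s\<^sup>2 + s^4 = (a\<^sup>2 + b\<^sup>2)\<^sup>2"
  proof -
    have "r^4 - r\<^sup>2 * s\<^sup>2 + s^4 = (r\<^sup>2 - s\<^sup>2)\<^sup>2 + (r * s)\<^sup>2"
      by (simp add: power2_eq_square power4_eq_xxxx algebra_simps)
    also have "r * s = 2 * a * b" using rs(3) by simp
    also have "r\<^sup>2 - s\<^sup>2 = a\<^sup>2 - b\<^sup>2" using rs(2) by simp
    finally show ?thesis by (simp add: power2_eq_square algebra_simps)
  qed
  moreover have "\<bar>a\<^sup>2 + b\<^sup>2\<bar> < \<bar>z\<bar>"
  proof -
    have "z\<^sup>2 = (a\<^sup>2 + b\<^sup>2)\<^sup>2 + 12 * (a * b)\<^sup>2"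
      unfolding eq'[symmetric] by (simp add: power2_eq_square algebra_simps)
    then have "z\<^sup>2 > (a\<^sup>2 + b\<^sup>2)\<^sup>2" using \<open>a * b \<noteq> 0\<close> by (smt (verit) zero_less_power2)
    then show ?thesis by (metis abs_le_square_iff not_le)
  qed
  ultimately show ?thesis using that rs(1) by blast
qed

theorem quartic_minus_square:
  fixes x y z :: int
  assumes "coprime x y" "x^4 - x\<^sup>2 * y\<^sup>2 + y^4 = z\<^sup>2"
  shows "x * y = 0 \<or> x\<^sup>2 = y\<^sup>2"
  using assms
proof (induction "nat \<bar>z\<bar>" arbitrary: x y z rule: less_induct)
  case less
  show ?case
  proof (rule ccontr)
    assume "\<not> ?thesis"
    then have nt: "x * y \<noteq> 0" "x\<^sup>2 \<noteq> y\<^sup>2" by auto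
    have yx: "coprime y x" "y^4 - y\<^sup>2 * x\<^sup>2 + x^4 = z\<^sup>2" "y * x \<noteq> 0"
      using less.prems nt by (auto simp: coprime_commute algebra_simps)
    obtain x' y' z' :: int where "coprime x' y'" "x' * y' \<noteq> 0" "x'\<^sup>2 \<noteq> y'\<^sup>2"
      "x'^4 - x'\<^sup>2 * y'\<^sup>2 + y'^4 = z'\<^sup>2" "\<bar>z'\<bar> < \<bar>z\<bar>"
    proof (cases "even x \<or> even y")
      case True
      then show ?thesis
        using quartic_minus_descent_even[OF less.prems(1) _ less.prems(2) nt(1)]
          quartic_minus_descent_even[OF yx(1) _ yx(2,3)] that by metis
    next
      case False
      then show ?thesis
        using quartic_minus_descent_odd[OF less.prems(1) _ _ less.prems(2) nt(2)] that by auto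
    qed
    moreover from this have "nat \<bar>z'\<bar> < nat \<bar>z\<bar>" by simp
    ultimately show False using less.hyps by blast
  qed
qed

lemma quartic_plus_descent:
  fixes x y w :: int
  assumes xy: "coprime x y" and ev: "even x" and eq: "x^4 + x\<^sup>2 * y\<^sup>2 + y^4 = w\<^sup>2" and nz: "x * y \<noteq> 0"
  obtains u v p q where "coprime u v" "v\<^sup>2 + u\<^sup>2 = p\<^sup>2" "v\<^sup>2 - 3 * u\<^sup>2 = q\<^sup>2" "u \<noteq> 0" "\<bar>u\<bar> < \<bar>x * y\<bar>"
proof -
  have "odd y" using xy ev by (metis coprime_common_divisor odd_one)
  have eq': "w\<^sup>2 + (x * y)\<^sup>2 = (x\<^sup>2 + y\<^sup>2)\<^sup>2"
    using eq by (simp add: power2_eq_square power4_eq_xxxx algebra_simps)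
  have "coprime w (x * y)"
  proof -
    have *: "coprime w x" if "coprime x y" "x^4 + x\<^sup>2 * y\<^sup>2 + y^4 = w\<^sup>2" for x y :: int
    proof (rule coprimeI)
      fix c assume c: "c dvd w" "c dvd x"
      have "y^4 = w * w - x * (x * x\<^sup>2 + x * y\<^sup>2)"
        using that(2) by (simp add: power2_eq_square power4_eq_xxxx algebra_simps)
      then have "c dvd y^4" using c by (metis dvd_diff dvd_mult2)
      moreover have "coprime c (y^4)"
        using that(1) c(2) by (metis coprime_power_right_iff coprime_divisors dvd_refl)
      ultimately show "is_unit c" by (metis coprime_common_divisor dvd_refl)
    qed
    have "coprime w x" using *[OF xy eq] .
    moreover have "coprime w y"
      using *[of y x] xy eq by (simp add: coprime_commute algebra_simps)
    ultimately show ?thesis by simp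
  qed
  then obtain r s where rs: "coprime r s" "x * y = 2 * r * s" "\<bar>x\<^sup>2 + y\<^sup>2\<bar> = r\<^sup>2 + s\<^sup>2"
    using primitive_pythagorean[OF _ _ eq'] ev by (metis even_mult_iff)
  have sq: "x\<^sup>2 + y\<^sup>2 = r\<^sup>2 + s\<^sup>2" using rs(3) by simp
  obtain X where X: "x = 2 * X" using ev by blast
  have "X * y = r * s" "X \<noteq> 0" using rs(2) X nz by auto
  then obtain \<alpha> \<beta> \<gamma> \<delta> where f: "X = \<alpha> * \<beta>" "y = \<gamma> * \<delta>" "r = \<alpha> * \<gamma>" "s = \<beta> * \<delta>"
    by (rule four_numbers)
  have nz': "\<alpha> \<noteq> 0" "\<beta> \<noteq> 0" "\<gamma> \<noteq> 0" "\<delta> \<noteq> 0" using nz X f by auto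
  have cop: "coprime \<alpha> \<delta>" "coprime \<beta> \<gamma>" "coprime \<alpha> \<beta>" using xy X f rs(1) by auto
  have "\<alpha>\<^sup>2 * (4 * \<beta>\<^sup>2 - \<gamma>\<^sup>2) = \<delta>\<^sup>2 * (\<beta>\<^sup>2 - \<gamma>\<^sup>2)"
    using sq unfolding X f by (simp add: power2_eq_square algebra_simps)
  then obtain \<kappa> where k: "\<beta>\<^sup>2 - \<gamma>\<^sup>2 = \<alpha>\<^sup>2 * \<kappa>" "4 * \<beta>\<^sup>2 - \<gamma>\<^sup>2 = \<delta>\<^sup>2 * \<kappa>"
    using proportional_coprime_squares cop nz' by metis
  have k3: "3 * \<beta>\<^sup>2 = \<kappa> * (\<delta>\<^sup>2 - \<alpha>\<^sup>2)" "3 * \<gamma>\<^sup>2 = \<kappa> * (\<delta>\<^sup>2 - 4 * \<alpha>\<^sup>2)"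
    using k by (auto simp: algebra_simps)
  have "\<kappa> \<in> {1, -1, 3, -3}"
    using dvd_three_int[OF cop(2), of \<kappa>] k3 by (metis dvd_triv_left)
  moreover have "\<kappa> \<noteq> 1 \<and> \<kappa> \<noteq> -3"
  proof -
    have "odd \<gamma>" "odd \<delta>" using \<open>odd y\<close> f by auto
    then have "\<gamma>\<^sup>2 mod 4 = 1" "\<delta>\<^sup>2 mod 4 = 1" using square_mod_4_int by simp_all
    moreover have "4 * \<beta>\<^sup>2 = \<gamma>\<^sup>2 + \<kappa> * \<delta>\<^sup>2" using k(2) by (simp add: algebra_simps)
    ultimately show ?thesis by (intro conjI notI) (simp; presburger)+
  qed
  ultimately consider "\<kappa> = 3" | "\<kappa> = -1" by auto
  then show ?thesis
  proof cases
    case 1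
    have "\<bar>\<alpha>\<bar> < \<bar>x * y\<bar>"
    proof -
      have "\<bar>x * y\<bar> = \<bar>\<alpha>\<bar> * (2 * \<bar>\<beta> * \<gamma> * \<delta>\<bar>)" by (simp add: X f abs_mult)
      also have "\<dots> \<ge> \<bar>\<alpha>\<bar> * 2" using nz' by (intro mult_left_mono) (simp_all add: one_le_abs_int)
      finally show ?thesis using nz' by simp
    qed
    moreover have "\<beta>\<^sup>2 + \<alpha>\<^sup>2 = \<delta>\<^sup>2" "\<beta>\<^sup>2 - 3 * \<alpha>\<^sup>2 = \<gamma>\<^sup>2" using k3 1 by auto
    ultimately show ?thesis using that cop(3) nz' by blast
  next
    case 2
    have "\<bar>\<beta>\<bar> < \<bar>x * y\<bar>"
    proof -
      have "\<bar>x * y\<bar> = \<bar>\<beta>\<bar> * (2 * \<bar>\<alpha> * \<gamma> * \<delta>\<bar>)" by (simp add: X f abs_mult)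
      also have "\<dots> \<ge> \<bar>\<beta>\<bar> * 2" using nz' by (intro mult_left_mono) (simp_all add: one_le_abs_int)
      finally show ?thesis using nz' by simp
    qed
    moreover have "\<alpha>\<^sup>2 + \<beta>\<^sup>2 = \<gamma>\<^sup>2" "\<alpha>\<^sup>2 - 3 * \<beta>\<^sup>2 = \<delta>\<^sup>2" using k 2 by auto
    ultimately show ?thesis using that[of \<beta> \<alpha>] cop(3) nz' by (metis coprime_commute)
  qed
qed

theorem concordant_one_minus_three:
  fixes u v p q :: int
  assumes "coprime u v" "v\<^sup>2 + u\<^sup>2 = p\<^sup>2" "v\<^sup>2 - 3 * u\<^sup>2 = q\<^sup>2"
  shows "u = 0"
  using assms
proof (induction "nat \<bar>u\<bar>" arbitrary: u v p q rule: less_induct)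
  case less
  show ?case
  proof (rule ccontr)
    assume "u \<noteq> 0"
    have "even u \<and> odd v"
    proof -
      have "odd u \<or> odd v" using less.prems(1) by (metis coprime_common_divisor odd_one)
      moreover have False if "odd u" "odd v"
        using less.prems(2) that square_mod_4_int[of u] square_mod_4_int[of v] square_mod_4_int[of p]
        by presburger
      moreover have False if "odd u" "even v"
      proof -
        obtain v' where "v = 2 * v'" using \<open>even v\<close> by blast
        then have v4: "v\<^sup>2 = 4 * v'\<^sup>2" by simp
        have "odd (p\<^sup>2)" using less.prems(2) that by (metis even_add even_power zero_less_numeral)
        moreover have "odd (q\<^sup>2)" unfolding less.prems(3)[symmetric] using that by simp
        ultimately show False
          using less.prems(2,3) v4 that(1) odd_square_mod_8_int[of p] odd_square_mod_8_int[of q] odd_square_mod_8_int[of u]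
          by simp presburger
      qed
      ultimately show ?thesis by blast
    qed
    then have "even u" "odd v" by auto
    have "odd p" using less.prems(2) \<open>even u\<close> \<open>odd v\<close> by (metis even_add even_power zero_less_numeral)
    have "odd q"
    proof -
      have "odd (q\<^sup>2)" unfolding less.prems(3)[symmetric] using \<open>even u\<close> \<open>odd v\<close> by simp
      then show ?thesis by simp
    qed
    define P where "P = \<bar>p\<bar>"
    have P: "odd P" "v\<^sup>2 + u\<^sup>2 = P\<^sup>2" "P \<ge> 0" using \<open>odd p\<close> less.prems(2) by (auto simp: P_def)
    obtain A where A: "P + q = 2 * A" using P(1) \<open>odd q\<close> by (metis odd_even_add dvdE)
    obtain B where B: "P - q = 2 * B" using P(1) \<open>odd q\<close> by (metis even_diff odd_even_add dvdE)
    have PA: "P = A + B" "q = A - B" using A B by auto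
    have "4 * (A * B) = 4 * u\<^sup>2"
      using P(2) less.prems(3) unfolding PA by (simp add: power2_eq_square algebra_simps)
    then have AB: "A * B = u\<^sup>2" by simp
    have "coprime A B"
    proof (rule coprimeI)
      fix c assume c: "c dvd A" "c dvd B"
      have "c\<^sup>2 dvd u\<^sup>2" unfolding AB[symmetric] using c by (metis mult_dvd_mono power2_eq_square)
      moreover have "c\<^sup>2 dvd P\<^sup>2" using c by (simp add: PA)
      ultimately have "c\<^sup>2 dvd v\<^sup>2" using P(2) by (metis dvd_add_left_iff)
      with \<open>c\<^sup>2 dvd u\<^sup>2\<close> have "c dvd u" "c dvd v" by auto
      then show "is_unit c" using less.prems(1) by (metis coprime_common_divisor)
    qed
    have "A \<ge> 0 \<and> B \<ge> 0"
    proof -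
      have "q\<^sup>2 \<le> P\<^sup>2" using P(2) less.prems(3) by (smt (verit) zero_le_power2)
      then have "\<bar>q\<bar> \<le> P" using P(3) by (metis abs_le_square_iff abs_of_nonneg)
      then show ?thesis using A B by auto
    qed
    obtain x where x: "A = x\<^sup>2"
      using coprime_mult_eq_square_int[OF \<open>coprime A B\<close> AB] \<open>A \<ge> 0 \<and> B \<ge> 0\<close> by auto
    obtain y where y: "B = y\<^sup>2"
      using coprime_mult_eq_square_int[of B A u] \<open>coprime A B\<close> AB \<open>A \<ge> 0 \<and> B \<ge> 0\<close>
      by (metis abs_of_nonneg coprime_commute mult.commute)
    have xy: "coprime x y" using \<open>coprime A B\<close> x y by simp
    have xyu: "(x * y)\<^sup>2 = u\<^sup>2" using AB x y by (simp add: power_mult_distrib)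
    then have abs: "\<bar>x * y\<bar> = \<bar>u\<bar>" by (metis abs_eq_iff power2_eq_iff)
    have eq: "x^4 + x\<^sup>2 * y\<^sup>2 + y^4 = v\<^sup>2"
      using P(2) unfolding PA(1) x y xyu[symmetric]
      by (simp add: power2_eq_square power4_eq_xxxx algebra_simps)
    have nz: "x * y \<noteq> 0" using abs \<open>u \<noteq> 0\<close> by auto
    have "even (x * y)" using abs \<open>even u\<close> by (metis dvd_abs_iff)
    then consider "even x" | "even y" by auto
    then obtain u' v' p' q' where *: "coprime u' v'" "v'\<^sup>2 + u'\<^sup>2 = p'\<^sup>2" "v'\<^sup>2 - 3 * u'\<^sup>2 = q'\<^sup>2"
        "u' \<noteq> 0" "\<bar>u'\<bar> < \<bar>u\<bar>"
    proof cases
      case 1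
      then show ?thesis using quartic_plus_descent[OF xy _ eq nz] that abs by metis
    next
      case 2
      have "coprime y x" "y^4 + y\<^sup>2 * x\<^sup>2 + x^4 = v\<^sup>2" "y * x \<noteq> 0" "\<bar>y * x\<bar> = \<bar>u\<bar>"
        using xy eq nz abs by (auto simp: coprime_commute algebra_simps)
      then show ?thesis using quartic_plus_descent[of y x v] 2 that by metis
    qed
    then have "nat \<bar>u'\<bar> < nat \<bar>u\<bar>" by simp
    from less.hyps[OF this *(1-3)] *(4) show False by simp
  qed
qed

lemma squares_sum_and_shifted_sum:
  fixes m n A B :: int
  assumes mn: "coprime m n" and "even m \<noteq> even n" and A: "m\<^sup>2 + n\<^sup>2 = A\<^sup>2" and B: "m\<^sup>2 + 4 * m * n + n\<^sup>2 = B\<^sup>2"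
  shows "m * n = 0"
proof (rule ccontr)
  assume nz: "m * n \<noteq> 0"
  have "odd (m\<^sup>2 + n\<^sup>2)" using assms(2) by simp
  then have "odd A" using A by simp
  have "odd (m\<^sup>2 + 4 * m * n + n\<^sup>2)" using assms(2) by simp
  then have "odd B" using B by simp
  obtain X where X: "B + A = 2 * X" using \<open>odd A\<close> \<open>odd B\<close> by (metis odd_even_add dvdE)
  obtain Y where Y: "B - A = 2 * Y" using \<open>odd A\<close> \<open>odd B\<close> by (metis even_diff odd_even_add dvdE)
  have AB: "A = X - Y" "B = X + Y" using X Y by auto
  have XY: "X * Y = m * n"
    using A B unfolding AB by (simp add: power2_eq_square algebra_simps)
  have sum: "X\<^sup>2 + Y\<^sup>2 = (m + n)\<^sup>2"
    using A B XY unfolding AB by (simp add: power2_eq_square algebra_simps)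
  have "coprime X Y"
  proof (rule coprimeI)
    fix c assume c: "c dvd X" "c dvd Y"
    have "c\<^sup>2 dvd m * n" unfolding XY[symmetric] using c by (metis mult_dvd_mono power2_eq_square)
    moreover have "c\<^sup>2 dvd (m + n)\<^sup>2" unfolding sum[symmetric] using c by simp
    then have "c dvd m + n" by simp
    ultimately have "c dvd m * n" "c dvd m + n" by (auto simp: power2_eq_square dest: dvd_mult_left)
    moreover have "coprime (m + n) (m * n)" using mn by (rule coprime_add_mult)
    ultimately show "is_unit c" by (metis coprime_common_divisor)
  qed
  have "X \<noteq> 0" using XY nz by auto
  then obtain \<alpha> \<beta> \<gamma> \<delta> where f: "X = \<alpha> * \<beta>" "Y = \<gamma> * \<delta>" "m = \<alpha> * \<gamma>" "n = \<beta> * \<delta>"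
    using four_numbers[OF XY] by blast
  have nz': "\<alpha> \<noteq> 0" "\<beta> \<noteq> 0" "\<gamma> \<noteq> 0" "\<delta> \<noteq> 0" using nz f by auto
  have cop: "coprime \<alpha> \<beta>" "coprime \<alpha> \<gamma>" "coprime \<alpha> \<delta>" "coprime \<beta> \<gamma>" "coprime \<beta> \<delta>" "coprime \<gamma> \<delta>"
    using mn \<open>coprime X Y\<close> f by auto
  have key: "(\<alpha>\<^sup>2 - \<delta>\<^sup>2) * (\<beta>\<^sup>2 - \<gamma>\<^sup>2) = 2 * (\<alpha> * \<delta>) * (\<beta> * \<gamma>)"
    using sum unfolding f by (simp add: power2_eq_square algebra_simps)
  have c1: "coprime (\<beta> * \<gamma>) (\<beta>\<^sup>2 - \<gamma>\<^sup>2)" using coprime_diff_squares[OF cop(4)] by (simp add: coprime_commute)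
  have "\<beta> * \<gamma> dvd (\<alpha>\<^sup>2 - \<delta>\<^sup>2) * (\<beta>\<^sup>2 - \<gamma>\<^sup>2)" unfolding key by simp
  then have "\<beta> * \<gamma> dvd \<alpha>\<^sup>2 - \<delta>\<^sup>2" using c1 by (metis coprime_dvd_mult_left_iff)
  then obtain k where k: "\<alpha>\<^sup>2 - \<delta>\<^sup>2 = \<beta> * \<gamma> * k" by blast
  have c2: "coprime (\<alpha> * \<delta>) (\<alpha>\<^sup>2 - \<delta>\<^sup>2)" using coprime_diff_squares[OF cop(3)] by (simp add: coprime_commute)
  have "\<alpha> * \<delta> dvd (\<alpha>\<^sup>2 - \<delta>\<^sup>2) * (\<beta>\<^sup>2 - \<gamma>\<^sup>2)" unfolding key by simp
  then have "\<alpha> * \<delta> dvd \<beta>\<^sup>2 - \<gamma>\<^sup>2" using c2 by (metis coprime_dvd_mult_right_iff)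
  then obtain l where l: "\<beta>\<^sup>2 - \<gamma>\<^sup>2 = \<alpha> * \<delta> * l" by blast
  have "(\<alpha> * \<delta> * (\<beta> * \<gamma>)) * (k * l) = (\<alpha> * \<delta> * (\<beta> * \<gamma>)) * 2"
    using key unfolding k l by (simp add: algebra_simps)
  then have "k * l = 2" using nz' by simp
  have fin: False if "p\<^sup>2 - q\<^sup>2 = r * s * k" "r\<^sup>2 - s\<^sup>2 = p * q * l" "k * l = 2" "k\<^sup>2 = 1" "coprime p q"
      "p \<noteq> 0" "q \<noteq> 0" "r \<noteq> 0" "s \<noteq> 0" for p q r s k l :: int
  proof -
    have "l = k\<^sup>2 * l" using that(4) by simp
    also have "\<dots> = 2 * k" using that(3) by (simp add: power2_eq_square mult.assoc)
    finally have l: "l = 2 * k" .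
    then have l2: "l\<^sup>2 = 4" using that(4) by (simp add: power_mult_distrib)
    have "even l" using l by simp
    then have "even (r\<^sup>2 - s\<^sup>2)" using that(2) by simp
    then have "even (r\<^sup>2 + s\<^sup>2)" by simp
    then obtain h where h: "r\<^sup>2 + s\<^sup>2 = 2 * h" by blast
    have "4 * (p^4 - p\<^sup>2 * q\<^sup>2 + q^4) = 4 * (p\<^sup>2 - q\<^sup>2)\<^sup>2 + 4 * (p * q)\<^sup>2"
      by (simp add: power2_eq_square power4_eq_xxxx algebra_simps)
    also have "\<dots> = 4 * (r * s)\<^sup>2 * k\<^sup>2 + (r\<^sup>2 - s\<^sup>2)\<^sup>2"
      unfolding that(1,2) by (simp add: power_mult_distrib l2)
    also have "\<dots> = (r\<^sup>2 + s\<^sup>2)\<^sup>2"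
      unfolding that(4) by (simp add: power2_eq_square algebra_simps)
    finally have "p^4 - p\<^sup>2 * q\<^sup>2 + q^4 = h\<^sup>2" unfolding h by (simp add: power_mult_distrib)
    then have "p * q = 0 \<or> p\<^sup>2 = q\<^sup>2" using quartic_minus_square that(5) by blast
    then have "p\<^sup>2 = q\<^sup>2" using that by auto
    then have "r * s * k = 0" using that(1) by simp
    then show False using that by auto
  qed
  have "k dvd 2" using \<open>k * l = 2\<close> by (metis dvd_triv_left)
  then have "\<bar>k\<bar> \<le> 2" using dvd_imp_le_int[of 2 k] by simp
  moreover have "k \<noteq> 0" using \<open>k * l = 2\<close> by auto
  ultimately consider "k = 1 \<or> k = -1" | "k = 2" | "k = -2" by linarith
  then have "k\<^sup>2 = 1 \<or> l\<^sup>2 = 1"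
  proof cases
    case 3
    then have "l = -1" using \<open>k * l = 2\<close> by simp
    then show ?thesis by simp
  qed (use \<open>k * l = 2\<close> in auto)
  then show False
  proof
    assume "k\<^sup>2 = 1"
    with fin[OF k l \<open>k * l = 2\<close>] cop nz' show False by blast
  next
    assume "l\<^sup>2 = 1"
    with fin[OF l k] \<open>k * l = 2\<close> cop nz' show False by (simp add: mult.commute)
  qed
qed

section \<open>Rational points of the second curve and its twist\<close>

lemma coprime_mult_eq_unit_square:
  fixes P Q \<sigma> z :: int
  assumes "coprime P Q" "P * Q = \<sigma> * z\<^sup>2" "\<bar>\<sigma>\<bar> = 1"
  obtains p q where "\<bar>P\<bar> = p\<^sup>2" "\<bar>Q\<bar> = q\<^sup>2"
proof -
  have "\<bar>P\<bar> * \<bar>Q\<bar> = \<bar>\<sigma>\<bar> * z\<^sup>2" using assms(2) by (metis abs_mult abs_power2)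
  then have *: "\<bar>P\<bar> * \<bar>Q\<bar> = z\<^sup>2" "\<bar>Q\<bar> * \<bar>P\<bar> = z\<^sup>2" using assms(3) by (auto simp: mult.commute)
  have c: "coprime \<bar>P\<bar> \<bar>Q\<bar>" "coprime \<bar>Q\<bar> \<bar>P\<bar>" using assms(1) by (auto simp: coprime_commute)
  obtain p where "\<bar>P\<bar> = p\<^sup>2" using coprime_mult_eq_square_int[OF c(1) *(1)] by auto
  moreover obtain q where "\<bar>Q\<bar> = q\<^sup>2" using coprime_mult_eq_square_int[OF c(2) *(2)] by auto
  ultimately show ?thesis using that by blast
qed

theorem quartic_E2_int:
  fixes m n z \<sigma> :: int
  assumes mn: "coprime m n" and eq: "(m\<^sup>2 + n\<^sup>2) * (m\<^sup>2 + 4 * m * n + n\<^sup>2) = \<sigma> * z\<^sup>2" and s: "\<bar>\<sigma>\<bar> = 1"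
  shows "m * n = 0 \<or> \<sigma> = -1 \<and> m = - n"
proof (cases "even m \<longleftrightarrow> even n")
  case False
  let ?P = "m\<^sup>2 + n\<^sup>2" and ?Q = "m\<^sup>2 + 4 * m * n + n\<^sup>2"
  have "odd ?P" using False by simp
  have cop: "coprime ?P ?Q"
  proof (rule coprimeI)
    fix c assume c: "c dvd ?P" "c dvd ?Q"
    have "c dvd 4 * (m * n)" using dvd_diff[OF c(2,1)] by (simp add: algebra_simps)
    moreover have "coprime c (2\<^sup>2)"
    proof -
      have "odd c" using c(1) \<open>odd ?P\<close> by (metis dvd_trans)
      then show ?thesis by (simp only: coprime_power_right_iff coprime_right_2_iff_odd) simp
    qed
    ultimately have "c dvd m * n" by (simp add: coprime_dvd_mult_right_iff)
    moreover have "coprime ?P (m * n)" using mn by (rule coprime_sum_squares)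
    ultimately show "is_unit c" using c(1) by (metis coprime_common_divisor)
  qed
  obtain A B where A: "\<bar>?P\<bar> = A\<^sup>2" and B: "\<bar>?Q\<bar> = B\<^sup>2"
    using coprime_mult_eq_unit_square[OF cop eq s] by blast
  have "odd B"
  proof -
    have "odd ?Q" using False by simp
    then show ?thesis using B by (metis dvd_abs_iff even_power zero_less_numeral)
  qed
  have "?Q \<noteq> - (B\<^sup>2)"
  proof
    assume "?Q = - (B\<^sup>2)"
    then have "?P + B\<^sup>2 = 4 * (- (m * n))" by simp
    then have "(?P + B\<^sup>2) mod 4 = 0" by (simp only: mod_mult_self1_is_0)
    moreover have "B\<^sup>2 mod 4 = 1" using \<open>odd B\<close> square_mod_4_int by simp
    moreover have "m\<^sup>2 mod 4 + n\<^sup>2 mod 4 = 1"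
      using False square_mod_4_int[of m] square_mod_4_int[of n] by simp
    then have "?P mod 4 = 1" by presburger
    ultimately show False by presburger
  qed
  then have "?Q = B\<^sup>2" using B by linarith
  then show ?thesis using squares_sum_and_shifted_sum[OF mn] False A by simp
next
  case True
  then have "odd m" "odd n" using mn by (metis coprime_common_divisor odd_one)+
  obtain U where U: "m + n = 2 * U" using \<open>odd m\<close> \<open>odd n\<close> by (metis odd_even_add dvdE)
  obtain W where W: "m - n = 2 * W" using \<open>odd m\<close> \<open>odd n\<close> by (metis even_diff odd_even_add dvdE)
  have mUW: "m = U + W" "n = U - W" using U W by auto
  have cUW: "coprime U W"
    using mn unfolding mUW coprime_def by (meson dvd_add dvd_diff)
  define P where "P = U\<^sup>2 + W\<^sup>2"
  define Q where "Q = 3 * U\<^sup>2 - W\<^sup>2"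
  have PQ: "4 * (P * Q) = \<sigma> * z\<^sup>2"
    using eq unfolding mUW P_def Q_def by (simp add: power2_eq_square algebra_simps)
  have "odd (U + W)" using \<open>odd m\<close> mUW by simp
  then have "odd P" "odd Q" by (auto simp: P_def Q_def)
  have "even z"
  proof -
    have "even (\<sigma> * z\<^sup>2)" unfolding PQ[symmetric] by simp
    moreover have "odd \<sigma>" using s by (metis dvd_abs_iff odd_one)
    ultimately show ?thesis by simp
  qed
  then obtain y where "z = 2 * y" by blast
  then have PQ': "P * Q = \<sigma> * y\<^sup>2" using PQ by simp
  have cop: "coprime P Q"
  proof (rule coprimeI)
    fix c assume c: "c dvd P" "c dvd Q"
    have "odd c" using c(1) \<open>odd P\<close> by (metis dvd_trans)
    have "c dvd 2\<^sup>2 * U\<^sup>2" using dvd_add[OF c] by (simp add: P_def Q_def)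
    then have u: "c dvd U\<^sup>2"
      using \<open>odd c\<close> by (metis coprime_dvd_mult_right_iff coprime_power_right_iff coprime_right_2_iff_odd)
    then have "c dvd W\<^sup>2" using c(1) by (metis P_def dvd_add_right_iff)
    then show "is_unit c" using u cUW by (metis coprime_common_divisor coprime_power_left_iff coprime_power_right_iff)
  qed
  obtain p q where p: "\<bar>P\<bar> = p\<^sup>2" and q: "\<bar>Q\<bar> = q\<^sup>2"
    using coprime_mult_eq_unit_square[OF cop PQ' s] by blast
  have P: "P = p\<^sup>2" using p by (simp add: P_def)
  have "Q \<noteq> q\<^sup>2"
  proof
    assume "Q = q\<^sup>2"
    moreover have "odd p" "odd q" using P \<open>Q = q\<^sup>2\<close> \<open>odd P\<close> \<open>odd Q\<close> by auto
    ultimately have "(P + Q) mod 8 = 2" using P odd_square_mod_8_int[of p] odd_square_mod_8_int[of q] by presburger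
    moreover have "P + Q = 4 * U\<^sup>2" by (simp add: P_def Q_def)
    ultimately show False by presburger
  qed
  then have "Q = - (q\<^sup>2)" using q by linarith
  then have "W\<^sup>2 - 3 * U\<^sup>2 = q\<^sup>2" "W\<^sup>2 + U\<^sup>2 = p\<^sup>2" using P by (auto simp: P_def Q_def)
  then have "U = 0" using concordant_one_minus_three cUW by blast
  then have mn': "m = - n" using U by simp
  have "W \<noteq> 0" using \<open>U = 0\<close> \<open>odd (U + W)\<close> by auto
  have "P * Q < 0" using \<open>U = 0\<close> \<open>W \<noteq> 0\<close> by (simp add: P_def Q_def mult_less_0_iff)
  then have "\<sigma> * y\<^sup>2 < 0" using PQ' by simp
  then have "\<sigma> < 0" by (simp add: mult_less_0_iff)
  then have "\<sigma> = -1" using s by simp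
  with mn' show ?thesis by simp
qed

lemma rat_square_eq_of_int:
  fixes w :: rat
  assumes "w\<^sup>2 = of_int k"
  obtains z :: int where "k = z\<^sup>2"
proof -
  obtain p q where pq: "quotient_of w = (p, q)" by fastforce
  have q: "q > 0" and cop: "coprime p q" and w: "w = of_int p / of_int q"
    using pq quotient_of_denom_pos quotient_of_coprime quotient_of_div by blast+
  have "of_int (p\<^sup>2) = (of_int (k * q\<^sup>2) :: rat)"
    using assms q unfolding w by (simp add: power_divide field_simps)
  then have eq: "p\<^sup>2 = k * q\<^sup>2" by (simp only: of_int_eq_iff)
  then have "q dvd p" by (metis dvd_triv_right pow_divides_pow_iff zero_less_numeral)
  then have "is_unit q" using cop by (metis coprime_absorb_right)
  then have "q = 1" using q by simp
  with eq have "k = p\<^sup>2" by simp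
  then show ?thesis by (rule that)
qed

theorem quartic_E2_rat:
  fixes t w :: rat and \<sigma> :: int
  assumes eq: "(t\<^sup>2 + 1) * (t\<^sup>2 + 4 * t + 1) = of_int \<sigma> * w\<^sup>2" and s: "\<bar>\<sigma>\<bar> = 1"
  shows "t = 0 \<or> \<sigma> = -1 \<and> t = -1"
proof -
  obtain m n where mn: "quotient_of t = (m, n)" by fastforce
  have n: "n > 0" and cop: "coprime m n" and t: "t = of_int m / of_int n"
    using mn quotient_of_denom_pos quotient_of_coprime quotient_of_div by blast+
  have ss: "of_int \<sigma> * of_int \<sigma> = (1::rat)"
    using s by (metis abs_mult_self_eq mult_1 of_int_1 of_int_mult)
  define k where "k = \<sigma> * ((m\<^sup>2 + n\<^sup>2) * (m\<^sup>2 + 4 * m * n + n\<^sup>2))"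
  have "of_int k = of_int \<sigma> * ((t\<^sup>2 + 1) * (t\<^sup>2 + 4 * t + 1)) * (of_int n ^ 4 :: rat)"
    using n unfolding k_def t by (simp add: power_divide field_simps power2_eq_square power4_eq_xxxx)
  also have "\<dots> = (of_int \<sigma> * of_int \<sigma>) * (w * of_int n ^ 2)\<^sup>2"
    unfolding eq by (simp add: power2_eq_square power4_eq_xxxx)
  finally have "(w * of_int n ^ 2)\<^sup>2 = (of_int k :: rat)" by (simp add: ss)
  then obtain z where z: "k = z\<^sup>2" by (rule rat_square_eq_of_int)
  have "(m\<^sup>2 + n\<^sup>2) * (m\<^sup>2 + 4 * m * n + n\<^sup>2) = \<sigma> * k"
    using s unfolding k_def by (metis abs_mult_self_eq mult.assoc mult_1)
  then have "m * n = 0 \<or> \<sigma> = -1 \<and> m = - n"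
    using quartic_E2_int[OF cop _ s] z by metis
  then show ?thesis using n t by auto
qed

section \<open>Reduction of binary quartic forms\<close>

text \<open>Every integral form that is equivalent to \<open>k (k\<^sup>3 - 4 k x\<^sup>2 + 4 x\<^sup>3)\<close> has the shape below, since
  shifting the binomial middle coefficient by \<open>1/3\<close> is invariant under unimodular substitutions.
  In these coordinates \<open>quartic_inv\<close> says that the classical invariants are \<open>I = 16\<close> and \<open>J = -304\<close>,
  and \<open>quartic_cov\<close> is one third of the form minus its Hessian.\<close>

definition quartic :: "'a::comm_ring_1 \<Rightarrow> 'a \<Rightarrow> 'a \<Rightarrow> 'a \<Rightarrow> 'a \<Rightarrow> 'a \<Rightarrow> 'a \<Rightarrow> 'a" where
  "quartic a b c d e x z = a * x^4 + 4 * b * x^3 * z + (2 + 6 * c) * x\<^sup>2 * z\<^sup>2 + 4 * d * x * z^3 + e * z^4"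

definition quartic_cov :: "'a::comm_ring_1 \<Rightarrow> 'a \<Rightarrow> 'a \<Rightarrow> 'a \<Rightarrow> 'a \<Rightarrow> 'a \<Rightarrow> 'a \<Rightarrow> 'a" where
  "quartic_cov a b c d e x z = (b\<^sup>2 - a * c) * x^4 + 2 * (b + b * c - a * d) * x^3 * z
     + (3 * c\<^sup>2 + 4 * c + 1 - a * e - 2 * b * d) * x\<^sup>2 * z\<^sup>2 + 2 * (d + c * d - b * e) * x * z^3 + (d\<^sup>2 - c * e) * z^4"

definition quartic_inv :: "'a::comm_ring_1 \<Rightarrow> 'a \<Rightarrow> 'a \<Rightarrow> 'a \<Rightarrow> 'a \<Rightarrow> bool" where
  "quartic_inv a b c d e \<longleftrightarrow> a * e - 4 * b * d + 3 * c\<^sup>2 + 2 * c = 1 \<and>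
     a * c * e + 2 * b * c * d - a * d\<^sup>2 - e * b\<^sup>2 - c^3 + 2 * b * d - 2 * c\<^sup>2 - c + 1 = 0"

lemma quartic_depressed:
  fixes a b c d e x z :: real
  assumes "quartic_inv a b c d e" and n: "n = b\<^sup>2 - a * c" and j: "j = a\<^sup>2 * d - a * b - b^3 + 3 * b * n"
    and X: "X = a * x + b * z"
  shows "a^3 * quartic a b c d e x z = X^4 + (2 * a - 6 * n) * X\<^sup>2 * z\<^sup>2 + 4 * j * X * z^3 + (a - n) * (a + 3 * n) * z^4"
    and "a^4 * quartic_cov a b c d e x z = n * X^4 - 2 * j * X^3 * z + 6 * n * (n - a) * X\<^sup>2 * z\<^sup>2 + 2 * j * (a - n) * X * z^3
      + (a^3 + a\<^sup>2 * n - 2 * a * n\<^sup>2 + n^3) * z^4"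
proof -
  define P where "P = a * e - 4 * b * d + 3 * c\<^sup>2 + 2 * c - 1"
  define J where "J = a * c * e + 2 * b * c * d - a * d\<^sup>2 - e * b\<^sup>2 - c^3 + 2 * b * d - 2 * c\<^sup>2 - c + 1"
  have 0: "P = 0" "J = 0" using assms(1) unfolding quartic_inv_def P_def J_def by auto
  have "a^3 * quartic a b c d e x z - (X^4 + (2 * a - 6 * n) * X\<^sup>2 * z\<^sup>2 + 4 * j * X * z^3 + (a - n) * (a + 3 * n) * z^4)
     = a\<^sup>2 * z^4 * P"
    unfolding quartic_def P_def X j n by algebra
  then show "a^3 * quartic a b c d e x z = X^4 + (2 * a - 6 * n) * X\<^sup>2 * z\<^sup>2 + 4 * j * X * z^3 + (a - n) * (a + 3 * n) * z^4"
    using 0 by simp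
  have "a^4 * quartic_cov a b c d e x z - (n * X^4 - 2 * j * X^3 * z + 6 * n * (n - a) * X\<^sup>2 * z\<^sup>2 + 2 * j * (a - n) * X * z^3
      + (a^3 + a\<^sup>2 * n - 2 * a * n\<^sup>2 + n^3) * z^4)
     = - (a^4 * x\<^sup>2 * z\<^sup>2 * P) - 2 * a^3 * b * x * z^3 * P - (a^3 * J + a\<^sup>2 * b\<^sup>2 * P) * z^4"
    unfolding quartic_cov_def P_def J_def X j n by algebra
  then show "a^4 * quartic_cov a b c d e x z = n * X^4 - 2 * j * X^3 * z + 6 * n * (n - a) * X\<^sup>2 * z\<^sup>2 + 2 * j * (a - n) * X * z^3
      + (a^3 + a\<^sup>2 * n - 2 * a * n\<^sup>2 + n^3) * z^4"
    using 0 by simp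
qed

lemma depressed_quartic_factorization:
  fixes a \<kappa> \<tau> Y u z :: real
  assumes c: "Y\<^sup>2 * (a * (6 * \<kappa> + 2) - Y\<^sup>2 - 4 * \<tau>\<^sup>2) = - (a\<^sup>2 * ((3 * \<kappa> - 1) * (\<kappa> + 1)))"
    and n: "n = \<tau>\<^sup>2 - \<kappa> * a" and j: "j = - (\<tau> * (Y\<^sup>2 + 2 * \<tau>\<^sup>2 - a * (1 + 3 * \<kappa>)))" and X: "X = u - \<tau> * z"
  shows "X^4 + (2 * a - 6 * n) * X\<^sup>2 * z\<^sup>2 + 4 * j * X * z^3 + (a - n) * (a + 3 * n) * z^4
      = (u\<^sup>2 + Y\<^sup>2 * z\<^sup>2) * (u\<^sup>2 - 4 * \<tau> * u * z + (a * (6 * \<kappa> + 2) - Y\<^sup>2) * z\<^sup>2)"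
  using c unfolding X j n by algebra

lemma depressed_covariant_expression:
  fixes a \<kappa> \<tau> Y u z :: real
  assumes k: "4 * \<kappa>^3 + 4 * \<kappa>\<^sup>2 = 1" and c: "Y\<^sup>2 * (a * (6 * \<kappa> + 2) - Y\<^sup>2 - 4 * \<tau>\<^sup>2) = - (a\<^sup>2 * ((3 * \<kappa> - 1) * (\<kappa> + 1)))"
    and n: "n = \<tau>\<^sup>2 - \<kappa> * a" and j: "j = - (\<tau> * (Y\<^sup>2 + 2 * \<tau>\<^sup>2 - a * (1 + 3 * \<kappa>)))" and X: "X = u - \<tau> * z"
  shows "4 * Y\<^sup>2 * (n * X^4 - 2 * j * X^3 * z + 6 * n * (n - a) * X\<^sup>2 * z\<^sup>2 + 2 * j * (a - n) * X * z^3
      + (a^3 + a\<^sup>2 * n - 2 * a * n\<^sup>2 + n^3) * z^4)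
      = 4 * \<kappa> * (\<kappa> + 1) * a\<^sup>2 * (u\<^sup>2 + Y\<^sup>2 * z\<^sup>2)\<^sup>2
        - (Y\<^sup>2 * (u\<^sup>2 - 4 * \<tau> * u * z + (a * (6 * \<kappa> + 2) - Y\<^sup>2) * z\<^sup>2) - (\<kappa> + 1) * a * (u\<^sup>2 + Y\<^sup>2 * z\<^sup>2))\<^sup>2"
  using c k unfolding X j n by algebra

text \<open>The number \<open>\<kappa>\<close> is the negative of the real root of \<open>4x\<^sup>3 - 4x\<^sup>2 + 1\<close>; six times it plus two is the
  real root of the resolvent cubic.\<close>

lemma covariant_cubic_root:
  obtains \<kappa> :: real where "4 * \<kappa>^3 + 4 * \<kappa>\<^sup>2 = 1" "0.4196 \<le> \<kappa>" "\<kappa> \<le> 0.4197"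
proof -
  have "\<exists>\<kappa>\<ge>0.4196. \<kappa> \<le> 0.4197 \<and> 4 * \<kappa>^3 + 4 * \<kappa>\<^sup>2 = (1::real)"
    by (rule IVT) (auto simp: power2_eq_square power3_eq_cube intro!: continuous_intros)
  then show ?thesis using that by blast
qed

lemma cubic_factor:
  fixes a n \<kappa> :: real
  assumes "4 * \<kappa>^3 + 4 * \<kappa>\<^sup>2 = 1"
  shows "4 * n^3 - 4 * a * n\<^sup>2 + a^3 = (n + \<kappa> * a) * ((2 * n - (1 + \<kappa>) * a)\<^sup>2 + (1 + \<kappa>) * (3 * \<kappa> - 1) * a\<^sup>2)"
  using assms by algebra

text \<open>A real form with these invariants splits into a definite and an indefinite quadratic factor. The
  definite one, normalised to determinant 1, is the form to be reduced; the value of \<open>quartic_cov\<close> at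
  a point depends only on the values of the two factors there.\<close>

lemma definite_covariant:
  fixes a b c d e \<kappa> :: real
  assumes inv: "quartic_inv a b c d e" and n: "n = b\<^sup>2 - a * c" and j: "j = a\<^sup>2 * d - a * b - b^3 + 3 * b * n"
    and syz: "j\<^sup>2 = 4 * n^3 - 4 * a * n\<^sup>2 + a^3"
    and "a > 0" and "j \<noteq> 0" and k: "4 * \<kappa>^3 + 4 * \<kappa>\<^sup>2 = 1" and k_gt: "\<kappa> > 1/3"
  obtains \<alpha> \<beta> \<gamma> where "\<alpha> > 0" "\<alpha> * \<gamma> - \<beta>\<^sup>2 = 1"
    "\<And>x z. \<exists>q. quartic a b c d e x z = (\<alpha> * x\<^sup>2 + 2 * \<beta> * x * z + \<gamma> * z\<^sup>2) * q \<and>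
        4 * quartic_cov a b c d e x z = 4 * \<kappa> * (\<kappa> + 1) * (\<alpha> * x\<^sup>2 + 2 * \<beta> * x * z + \<gamma> * z\<^sup>2)\<^sup>2
          - (q - (\<kappa> + 1) * (\<alpha> * x\<^sup>2 + 2 * \<beta> * x * z + \<gamma> * z\<^sup>2))\<^sup>2"
proof -
  define P where "P = (2 * n - (1 + \<kappa>) * a)\<^sup>2 + (1 + \<kappa>) * (3 * \<kappa> - 1) * a\<^sup>2"
  have pos: "(1 + \<kappa>) * (3 * \<kappa> - 1) * a\<^sup>2 > 0" using \<open>a > 0\<close> k_gt by simp
  then have "P > 0" by (simp add: P_def add_nonneg_pos)
  have jP: "j\<^sup>2 = (n + \<kappa> * a) * P" using syz cubic_factor[OF k] unfolding P_def by simp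
  moreover have "j\<^sup>2 > 0" using \<open>j \<noteq> 0\<close> by simp
  ultimately have "n + \<kappa> * a > 0" using \<open>P > 0\<close> by (simp add: zero_less_mult_iff)
  define \<tau> where "\<tau> = - sgn j * sqrt (n + \<kappa> * a)"
  have tau2: "\<tau>\<^sup>2 = n + \<kappa> * a"
    using \<open>n + \<kappa> * a > 0\<close> \<open>j \<noteq> 0\<close> by (simp add: \<tau>_def power_mult_distrib sgn_if)
  define \<rho> where "\<rho> = sqrt P"
  have rho2: "\<rho>\<^sup>2 = P" using \<open>P > 0\<close> by (simp add: \<rho>_def)
  have "\<bar>j\<bar> = sqrt (n + \<kappa> * a) * \<rho>" unfolding \<rho>_def real_sqrt_mult[symmetric] jP[symmetric] by simp
  then have jr: "j = - \<tau> * \<rho>"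
    unfolding \<tau>_def by (metis mult.assoc mult_minus_left minus_minus sgn_mult_abs)
  have "\<bar>2 * n - (1 + \<kappa>) * a\<bar> < \<rho>"
  proof -
    have "(2 * n - (1 + \<kappa>) * a)\<^sup>2 < P" using pos by (simp add: P_def)
    then show ?thesis unfolding \<rho>_def using real_sqrt_less_mono by fastforce
  qed
  then have Ypos: "\<rho> + a * (1 + \<kappa>) - 2 * n > 0" by (simp add: algebra_simps)
  define Y where "Y = sqrt (\<rho> + a * (1 + \<kappa>) - 2 * n)"
  have "Y > 0" using Ypos by (simp add: Y_def)
  have Y2: "Y\<^sup>2 = \<rho> + a * (1 + \<kappa>) - 2 * n" using Ypos by (simp add: Y_def)
  have n': "n = \<tau>\<^sup>2 - \<kappa> * a" using tau2 by simp
  have j': "j = - (\<tau> * (Y\<^sup>2 + 2 * \<tau>\<^sup>2 - a * (1 + 3 * \<kappa>)))"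
    unfolding jr Y2 tau2 by (simp add: algebra_simps)
  have c: "Y\<^sup>2 * (a * (6 * \<kappa> + 2) - Y\<^sup>2 - 4 * \<tau>\<^sup>2) = - (a\<^sup>2 * ((3 * \<kappa> - 1) * (\<kappa> + 1)))"
    using rho2 unfolding Y2 tau2 P_def by algebra
  define \<alpha> \<beta> \<gamma> where "\<alpha> = a / Y" and "\<beta> = (b + \<tau>) / Y" and "\<gamma> = ((b + \<tau>)\<^sup>2 + Y\<^sup>2) / (a * Y)"
  show ?thesis
  proof
    show "\<alpha> > 0" using \<open>a > 0\<close> \<open>Y > 0\<close> by (simp add: \<alpha>_def)
    show "\<alpha> * \<gamma> - \<beta>\<^sup>2 = 1"
      using \<open>a > 0\<close> \<open>Y > 0\<close> by (simp add: \<alpha>_def \<beta>_def \<gamma>_def field_simps power2_eq_square)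
    fix x z
    define X where "X = a * x + b * z"
    define u where "u = X + \<tau> * z"
    have X: "X = u - \<tau> * z" by (simp add: u_def)
    define R where "R = u\<^sup>2 + Y\<^sup>2 * z\<^sup>2"
    define Q where "Q = u\<^sup>2 - 4 * \<tau> * u * z + (a * (6 * \<kappa> + 2) - Y\<^sup>2) * z\<^sup>2"
    have phi: "\<alpha> * x\<^sup>2 + 2 * \<beta> * x * z + \<gamma> * z\<^sup>2 = R / (a * Y)"
      using \<open>a > 0\<close> \<open>Y > 0\<close>
      by (simp add: \<alpha>_def \<beta>_def \<gamma>_def R_def u_def X_def field_simps power2_eq_square)
    note dep = quartic_depressed[OF inv n j X_def]
    have g: "a^3 * quartic a b c d e x z = R * Q"
      using dep(1) depressed_quartic_factorization[OF c n' j' X] \<open>a > 0\<close> unfolding R_def Q_def by simp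
    have N: "4 * Y\<^sup>2 * (a^4 * quartic_cov a b c d e x z) = 4 * \<kappa> * (\<kappa> + 1) * a\<^sup>2 * R\<^sup>2 - (Y\<^sup>2 * Q - (\<kappa> + 1) * a * R)\<^sup>2"
      using dep(2) depressed_covariant_expression[OF k c n' j' X] \<open>a > 0\<close> unfolding R_def Q_def by simp
    show "\<exists>q. quartic a b c d e x z = (\<alpha> * x\<^sup>2 + 2 * \<beta> * x * z + \<gamma> * z\<^sup>2) * q \<and>
        4 * quartic_cov a b c d e x z = 4 * \<kappa> * (\<kappa> + 1) * (\<alpha> * x\<^sup>2 + 2 * \<beta> * x * z + \<gamma> * z\<^sup>2)\<^sup>2
          - (q - (\<kappa> + 1) * (\<alpha> * x\<^sup>2 + 2 * \<beta> * x * z + \<gamma> * z\<^sup>2))\<^sup>2"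
      unfolding phi
    proof (intro exI conjI)
      show "quartic a b c d e x z = R / (a * Y) * (Y * Q / a\<^sup>2)"
        using g \<open>a > 0\<close> \<open>Y > 0\<close> by (simp add: field_simps power2_eq_square power3_eq_cube)
      have "4 * quartic_cov a b c d e x z = (4 * \<kappa> * (\<kappa> + 1) * a\<^sup>2 * R\<^sup>2 - (Y\<^sup>2 * Q - (\<kappa> + 1) * a * R)\<^sup>2) / (Y\<^sup>2 * a^4)"
        unfolding N[symmetric] using \<open>a > 0\<close> \<open>Y > 0\<close> by simp
      also have "\<dots> = 4 * \<kappa> * (\<kappa> + 1) * (R / (a * Y))\<^sup>2 - (Y * Q / a\<^sup>2 - (\<kappa> + 1) * (R / (a * Y)))\<^sup>2"
      proof -
        have 1: "4 * \<kappa> * (\<kappa> + 1) * (R / (a * Y))\<^sup>2 = 4 * \<kappa> * (\<kappa> + 1) * a\<^sup>2 * R\<^sup>2 / (Y\<^sup>2 * a^4)"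
          using \<open>a > 0\<close> \<open>Y > 0\<close> by (simp add: field_simps power2_eq_square power4_eq_xxxx)
        have "Y * Q / a\<^sup>2 - (\<kappa> + 1) * (R / (a * Y)) = (Y\<^sup>2 * Q - (\<kappa> + 1) * a * R) / (Y * a\<^sup>2)"
          using \<open>a > 0\<close> \<open>Y > 0\<close> by (simp add: field_simps power2_eq_square)
        then have 2: "(Y * Q / a\<^sup>2 - (\<kappa> + 1) * (R / (a * Y)))\<^sup>2 = (Y\<^sup>2 * Q - (\<kappa> + 1) * a * R)\<^sup>2 / (Y\<^sup>2 * a^4)"
          by (simp add: power_divide power_mult_distrib flip: power_mult)
        show ?thesis unfolding 1 2 by (simp add: diff_divide_distrib)
      qed
      finally show "4 * quartic_cov a b c d e x z = 4 * \<kappa> * (\<kappa> + 1) * (R / (a * Y))\<^sup>2 - (Y * Q / a\<^sup>2 - (\<kappa> + 1) * (R / (a * Y)))\<^sup>2" .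
    qed
  qed
qed

lemma quartic_inv_syzygy_aux:
  fixes a b c d e :: int
  defines "n \<equiv> b\<^sup>2 - a * c" and "j \<equiv> a\<^sup>2 * d - a * b - b^3 + 3 * b * (b\<^sup>2 - a * c)"
  shows "j\<^sup>2 - (4 * n^3 - 4 * a * n\<^sup>2 + a^3) =
     - (a^2 * n * (a * e - 4 * b * d + 3 * c\<^sup>2 + 2 * c - 1))
     - a^3 * (a * c * e + 2 * b * c * d - a * d\<^sup>2 - e * b\<^sup>2 - c^3 + 2 * b * d - 2 * c\<^sup>2 - c + 1)"
  unfolding n_def j_def by algebra

lemma quartic_inv_syzygy:
  fixes a b c d e n j :: int
  assumes "quartic_inv a b c d e" and n: "n = b\<^sup>2 - a * c" and j: "j = a\<^sup>2 * d - a * b - b^3 + 3 * b * n"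
  shows "j\<^sup>2 = 4 * n^3 - 4 * a * n\<^sup>2 + a^3"
proof -
  have I: "a * e - 4 * b * d + 3 * c\<^sup>2 + 2 * c - 1 = 0" and
    J: "a * c * e + 2 * b * c * d - a * d\<^sup>2 - e * b\<^sup>2 - c^3 + 2 * b * d - 2 * c\<^sup>2 - c + 1 = 0"
    using assms(1) unfolding quartic_inv_def by auto
  show ?thesis using quartic_inv_syzygy_aux[of a d b c e] unfolding I J n j by simp
qed

lemma coprime_dvd_cancel:
  fixes a b c :: int
  assumes "a dvd b * c" "coprime b a" shows "a dvd c"
  using assms by (metis coprime_commute coprime_dvd_mult_right_iff)

text \<open>The point \<open>n / e\<^sup>2\<close> of \<open>y\<^sup>2 = 4x\<^sup>3 - 4x\<^sup>2 + 1\<close> yields the quartic of its 2-covering, made integral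
  by a translation by \<open>b / e\<^sup>2\<close>.\<close>

lemma covering_divisibility:
  fixes e n j :: int
  assumes cop: "coprime e n" and eq: "j\<^sup>2 = e^6 - 4 * e\<^sup>2 * n\<^sup>2 + 4 * n^3"
  obtains b where "e\<^sup>2 dvd b\<^sup>2 - n" "e^4 dvd j + e\<^sup>2 * b + b^3 - 3 * b * n"
    "e^6 dvd b^4 - 6 * n * b\<^sup>2 + 2 * e\<^sup>2 * b\<^sup>2 + 4 * j * b + e^4 + 2 * n * e\<^sup>2 - 3 * n\<^sup>2"
proof (cases "even e")
  case False
  have "coprime (2 * n) (e\<^sup>2)"
    using cop False by (simp add: coprime_commute)
  then obtain u v where "u * (2 * n) + v * e\<^sup>2 = 1" by (metis bezout_int coprime_iff_gcd_eq_1)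
  then have "2 * n * (u * j) = j + e\<^sup>2 * (- (v * j))" by algebra
  then obtain b s where bs: "2 * n * b = j + e\<^sup>2 * s" by blast
  have c: "coprime ((2 * n)^k) (e^l)" for k l
    using cop False by (simp add: coprime_commute)
  have "(2 * n)^2 * (b\<^sup>2 - n) = e\<^sup>2 * (e^4 - 4 * n\<^sup>2 + 2 * j * s + e\<^sup>2 * s\<^sup>2)"
    using bs eq by algebra
  then have 1: "e\<^sup>2 dvd b\<^sup>2 - n" using c coprime_dvd_cancel by (metis dvd_triv_left)
  have "(2 * n)^3 * (j + e\<^sup>2 * b + b^3 - 3 * b * n) =
     e^4 * (j * e\<^sup>2 + 3 * s * (e^4 - 4 * n\<^sup>2) + 4 * n\<^sup>2 * s + 3 * j * s\<^sup>2 + e\<^sup>2 * s^3)"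
    using bs eq by algebra
  then have 2: "e^4 dvd j + e\<^sup>2 * b + b^3 - 3 * b * n" using c coprime_dvd_cancel by (metis dvd_triv_left)
  have "(2 * n)^4 * (b^4 - 6 * n * b\<^sup>2 + 2 * e\<^sup>2 * b\<^sup>2 + 4 * j * b + e^4 + 2 * n * e\<^sup>2 - 3 * n\<^sup>2) =
     e^6 * (16 * n^3 + e^6 + 4 * j * e\<^sup>2 * s + s\<^sup>2 * (6 * e^4 - 16 * n\<^sup>2) + 4 * j * s^3 + e\<^sup>2 * s^4)"
    using bs eq by algebra
  then have "e^6 dvd b^4 - 6 * n * b\<^sup>2 + 2 * e\<^sup>2 * b\<^sup>2 + 4 * j * b + e^4 + 2 * n * e\<^sup>2 - 3 * n\<^sup>2"
    using c coprime_dvd_cancel by (metis dvd_triv_left)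
  with 1 2 show ?thesis by (rule that)
next
  case True
  then obtain f where f: "e = 2 * f" by blast
  have "even (j\<^sup>2)" unfolding eq using True by simp
  then obtain i where i: "j = 2 * i" by auto
  have eqi: "i\<^sup>2 = 16 * f^6 - 4 * f\<^sup>2 * n\<^sup>2 + n^3"
  proof -
    have "4 * i\<^sup>2 = 4 * (16 * f^6 - 4 * f\<^sup>2 * n\<^sup>2 + n^3)" using eq unfolding f i by algebra
    then show ?thesis by simp
  qed
  have "coprime n (e\<^sup>2)"
    using cop by (simp add: coprime_commute)
  then obtain u v where "u * n + v * e\<^sup>2 = 1" by (metis bezout_int coprime_iff_gcd_eq_1)
  then have "n * (u * i) = i + e\<^sup>2 * (- (v * i))" by algebra
  then obtain b s where bs: "n * b = i + e\<^sup>2 * s" by blast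
  have c: "coprime (n^k) (e^l)" for k l
    using cop by (simp add: coprime_commute)
  have "n^2 * (b\<^sup>2 - n) = e\<^sup>2 * (4 * f^4 - n\<^sup>2 + 2 * i * s + e\<^sup>2 * s\<^sup>2)"
    using bs eqi f by algebra
  then have 1: "e\<^sup>2 dvd b\<^sup>2 - n" using c coprime_dvd_cancel by (metis dvd_triv_left)
  have "n^3 * (j + e\<^sup>2 * b + b^3 - 3 * b * n) =
     e^4 * (i * f\<^sup>2 + s * (12 * f^4 - 2 * n\<^sup>2) + 3 * i * s\<^sup>2 + e\<^sup>2 * s^3)"
    using bs eqi unfolding f i by algebra
  then have 2: "e^4 dvd j + e\<^sup>2 * b + b^3 - 3 * b * n" using c coprime_dvd_cancel by (metis dvd_triv_left)
  have "n^4 * (b^4 - 6 * n * b\<^sup>2 + 2 * e\<^sup>2 * b\<^sup>2 + 4 * j * b + e^4 + 2 * n * e\<^sup>2 - 3 * n\<^sup>2) =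
     e^6 * (n^3 + 4 * f^6 + i * e\<^sup>2 * s + s\<^sup>2 * (24 * f^4 - 4 * n\<^sup>2) + 4 * i * s^3 + e\<^sup>2 * s^4)"
    using bs eqi unfolding f i by algebra
  then have "e^6 dvd b^4 - 6 * n * b\<^sup>2 + 2 * e\<^sup>2 * b\<^sup>2 + 4 * j * b + e^4 + 2 * n * e\<^sup>2 - 3 * n\<^sup>2"
    using c coprime_dvd_cancel by (metis dvd_triv_left)
  with 1 2 show ?thesis by (rule that)
qed

lemma covering_quartic:
  fixes e n j :: int
  assumes cop: "coprime e n" and "e \<noteq> 0" and eq: "j\<^sup>2 = e^6 - 4 * e\<^sup>2 * n\<^sup>2 + 4 * n^3"
  obtains b c d k where "quartic_inv (e\<^sup>2) b c d k" "n = b\<^sup>2 - e\<^sup>2 * c" "j = e^4 * d - e\<^sup>2 * b - b^3 + 3 * b * n"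
proof -
  obtain b where b: "e\<^sup>2 dvd b\<^sup>2 - n" "e^4 dvd j + e\<^sup>2 * b + b^3 - 3 * b * n"
    "e^6 dvd b^4 - 6 * n * b\<^sup>2 + 2 * e\<^sup>2 * b\<^sup>2 + 4 * j * b + e^4 + 2 * n * e\<^sup>2 - 3 * n\<^sup>2"
    using covering_divisibility[OF cop eq] by blast
  obtain c where c: "b\<^sup>2 - n = e\<^sup>2 * c" using b(1) by blast
  obtain d where d: "j + e\<^sup>2 * b + b^3 - 3 * b * n = e^4 * d" using b(2) by blast
  obtain k where k: "b^4 - 6 * n * b\<^sup>2 + 2 * e\<^sup>2 * b\<^sup>2 + 4 * j * b + e^4 + 2 * n * e\<^sup>2 - 3 * n\<^sup>2 = e^6 * k"
    using b(3) by blast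
  have n: "n = b\<^sup>2 - e\<^sup>2 * c" and j: "j = e^4 * d - e\<^sup>2 * b - b^3 + 3 * b * n" using c d by auto
  have "e^4 * (e\<^sup>2 * k - 4 * b * d + 3 * c\<^sup>2 + 2 * c - 1) = 0"
    using k unfolding j unfolding n by algebra
  then have I: "e\<^sup>2 * k - 4 * b * d + 3 * c\<^sup>2 + 2 * c - 1 = 0" using \<open>e \<noteq> 0\<close> by simp
  let ?J = "e\<^sup>2 * c * k + 2 * b * c * d - e\<^sup>2 * d\<^sup>2 - k * b\<^sup>2 - c^3 + 2 * b * d - 2 * c\<^sup>2 - c + 1"
  have "(e^4 * d - e\<^sup>2 * b - b^3 + 3 * b * n)\<^sup>2 - (4 * n^3 - 4 * e\<^sup>2 * n\<^sup>2 + e^6) = - (e^6 * ?J)"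
    using quartic_inv_syzygy_aux[of "e\<^sup>2" d b c k] unfolding I n[symmetric] by simp
  then have "e^6 * ?J = 0" using eq unfolding j[symmetric] by (simp add: algebra_simps)
  then have "?J = 0" using \<open>e \<noteq> 0\<close> by simp
  then have "quartic_inv (e\<^sup>2) b c d k" using I unfolding quartic_inv_def by simp
  then show ?thesis using n j that by blast
qed

lemma quartic_shift:
  fixes a b c d e k x z :: int
  shows "quartic a (b + k * a) (c + 2 * b * k + a * k\<^sup>2) (d + k * (1 + 3 * c) + 3 * b * k\<^sup>2 + a * k^3)
      (e + 4 * d * k + (2 + 6 * c) * k\<^sup>2 + 4 * b * k^3 + a * k^4) x z = quartic a b c d e (x + k * z) z"
    and "quartic_cov a (b + k * a) (c + 2 * b * k + a * k\<^sup>2) (d + k * (1 + 3 * c) + 3 * b * k\<^sup>2 + a * k^3)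
      (e + 4 * d * k + (2 + 6 * c) * k\<^sup>2 + 4 * b * k^3 + a * k^4) x z = quartic_cov a b c d e (x + k * z) z"
  unfolding quartic_def quartic_cov_def by algebra+

lemma quartic_swap:
  fixes a b c d e x z :: int
  shows "quartic e (-d) c (-b) a x z = quartic a b c d e (-z) x"
    and "quartic_cov e (-d) c (-b) a x z = quartic_cov a b c d e (-z) x"
  unfolding quartic_def quartic_cov_def by algebra+

lemma quartic_inv_shift:
  fixes a b c d e k :: int
  assumes "quartic_inv a b c d e"
  shows "quartic_inv a (b + k * a) (c + 2 * b * k + a * k\<^sup>2) (d + k * (1 + 3 * c) + 3 * b * k\<^sup>2 + a * k^3)
      (e + 4 * d * k + (2 + 6 * c) * k\<^sup>2 + 4 * b * k^3 + a * k^4)"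
  using assms unfolding quartic_inv_def by algebra

lemma quartic_inv_swap:
  fixes a b c d e :: int
  assumes "quartic_inv a b c d e"
  shows "quartic_inv e (-d) c (-b) a"
  using assms unfolding quartic_inv_def by algebra

lemma binary_form_minimal_vector:
  fixes \<alpha> \<beta> \<gamma> :: real and V :: "(int \<times> int) set"
  defines "\<phi> \<equiv> \<lambda>v. \<alpha> * (of_int (fst v))\<^sup>2 + 2 * \<beta> * of_int (fst v) * of_int (snd v) + \<gamma> * (of_int (snd v))\<^sup>2"
  assumes "\<alpha> > 0" and det: "\<alpha> * \<gamma> - \<beta>\<^sup>2 = 1" and "V \<noteq> {}"
  obtains v where "v \<in> V" "\<And>w. w \<in> V \<Longrightarrow> \<phi> v \<le> \<phi> w"
proof -
  have "\<alpha> * \<gamma> > 0" using det by (metis add_pos_nonneg diff_add_cancel zero_le_power2 zero_less_one)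
  then have "\<gamma> > 0" using \<open>\<alpha> > 0\<close> by (simp add: zero_less_mult_iff)
  obtain v0 where "v0 \<in> V" using \<open>V \<noteq> {}\<close> by blast
  define M where "M = \<phi> v0"
  define W where "W = {w \<in> V. \<phi> w \<le> M}"
  have int_le_sq: "\<bar>real_of_int i\<bar> \<le> (real_of_int i)\<^sup>2" for i
  proof -
    have "\<bar>i\<bar> * 1 \<le> \<bar>i\<bar> * \<bar>i\<bar>"
    proof (cases "i = 0")
      case False
      then show ?thesis by (intro mult_left_mono) (simp_all add: one_le_abs_int)
    qed simp
    then have "\<bar>i\<bar> \<le> i\<^sup>2" by (simp add: power2_eq_square)
    then show ?thesis by (metis of_int_abs of_int_le_iff of_int_power)
  qed
  have bound: "\<bar>fst w\<bar> \<le> \<lceil>\<gamma> * M\<rceil> \<and> \<bar>snd w\<bar> \<le> \<lceil>\<alpha> * M\<rceil>" if "w \<in> W" for w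
  proof -
    obtain x z where w: "w = (x, z)" by fastforce
    have le: "\<phi> w \<le> M" using that by (simp add: W_def)
    have "\<gamma> * \<phi> w = (\<beta> * x + \<gamma> * z)\<^sup>2 + (real_of_int x)\<^sup>2"
      using det unfolding \<phi>_def w fst_conv snd_conv by algebra
    then have "(real_of_int x)\<^sup>2 \<le> \<gamma> * \<phi> w" by simp
    also have "\<dots> \<le> \<gamma> * M" using le \<open>\<gamma> > 0\<close> by simp
    finally have 1: "\<bar>real_of_int x\<bar> \<le> \<gamma> * M" using int_le_sq[of x] by linarith
    have "\<alpha> * \<phi> w = (\<alpha> * x + \<beta> * z)\<^sup>2 + (real_of_int z)\<^sup>2"
      using det unfolding \<phi>_def w fst_conv snd_conv by algebra
    then have "(real_of_int z)\<^sup>2 \<le> \<alpha> * \<phi> w" by simp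
    also have "\<dots> \<le> \<alpha> * M" using le \<open>\<alpha> > 0\<close> by simp
    finally have 2: "\<bar>real_of_int z\<bar> \<le> \<alpha> * M" using int_le_sq[of z] by linarith
    have "\<bar>x\<bar> \<le> \<lceil>\<gamma> * M\<rceil>" "\<bar>z\<bar> \<le> \<lceil>\<alpha> * M\<rceil>" using 1 2 by linarith+
    then show ?thesis by (simp add: w)
  qed
  have "W \<subseteq> {-\<lceil>\<gamma> * M\<rceil>..\<lceil>\<gamma> * M\<rceil>} \<times> {-\<lceil>\<alpha> * M\<rceil>..\<lceil>\<alpha> * M\<rceil>}"
  proof
    fix w assume "w \<in> W"
    from bound[OF this] show "w \<in> {-\<lceil>\<gamma> * M\<rceil>..\<lceil>\<gamma> * M\<rceil>} \<times> {-\<lceil>\<alpha> * M\<rceil>..\<lceil>\<alpha> * M\<rceil>}"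
      by (cases w) (simp add: abs_le_iff; linarith)
  qed
  then have "finite W" by (rule finite_subset) simp
  have "v0 \<in> W" using \<open>v0 \<in> V\<close> by (simp add: W_def M_def)
  then have "W \<noteq> {}" by blast
  obtain v where v: "v \<in> W" "\<And>w. w \<in> W \<Longrightarrow> \<phi> v \<le> \<phi> w"
    using arg_min_if_finite(1)[OF \<open>finite W\<close> \<open>W \<noteq> {}\<close>] arg_min_least[OF \<open>finite W\<close> \<open>W \<noteq> {}\<close>] by blast
  have "\<phi> v \<le> \<phi> w" if "w \<in> V" for w
  proof (cases "w \<in> W")
    case False
    then have "\<phi> w > M" using that by (simp add: W_def)
    then show ?thesis using v(1) by (simp add: W_def)
  qed (use v(2) in simp)
  moreover have "v \<in> V" using v(1) by (simp add: W_def)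
  ultimately show ?thesis using that by blast
qed

text \<open>The matrix with rows \<open>p q\<close> and \<open>r s\<close> takes the first form to the second.\<close>

definition quartic_equiv :: "int \<times> int \<times> int \<times> int \<times> int \<Rightarrow> int \<times> int \<times> int \<times> int \<times> int \<Rightarrow> int \<Rightarrow> int \<Rightarrow> int \<Rightarrow> int \<Rightarrow> bool" where
  "quartic_equiv = (\<lambda>(a\<^sub>0, b\<^sub>0, c\<^sub>0, d\<^sub>0, e\<^sub>0) (a, b, c, d, e) p q r s.
     p * s - q * r = 1 \<and> quartic_inv a b c d e \<and>
     (\<forall>x z. quartic a b c d e x z = quartic a\<^sub>0 b\<^sub>0 c\<^sub>0 d\<^sub>0 e\<^sub>0 (p * x + q * z) (r * x + s * z)) \<and>
     (\<forall>x z. quartic_cov a b c d e x z = quartic_cov a\<^sub>0 b\<^sub>0 c\<^sub>0 d\<^sub>0 e\<^sub>0 (p * x + q * z) (r * x + s * z)))"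

lemma quartic_equiv_refl:
  "quartic_inv a b c d e \<Longrightarrow> quartic_equiv (a, b, c, d, e) (a, b, c, d, e) 1 0 0 1"
  by (simp add: quartic_equiv_def)

lemma quartic_equiv_shift:
  assumes "quartic_equiv Q (a, b, c, d, e) p q r s"
  obtains c' d' e' where "quartic_equiv Q (a, b + k * a, c', d', e') p (q + k * p) r (s + k * r)"
proof -
  obtain a0 b0 c0 d0 e0 where Q: "Q = (a0, b0, c0, d0, e0)" by (metis prod_cases5)
  have *: "p * (x + k * z) + q * z = p * x + (q + k * p) * z" for p q x z :: int by algebra
  have "p * (s + k * r) - (q + k * p) * r = p * s - q * r" by algebra
  then show ?thesis
    using assms that[of "c + 2 * b * k + a * k\<^sup>2" "d + k * (1 + 3 * c) + 3 * b * k\<^sup>2 + a * k^3"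
      "e + 4 * d * k + (2 + 6 * c) * k\<^sup>2 + 4 * b * k^3 + a * k^4"]
    unfolding Q quartic_equiv_def prod.case quartic_shift by (simp add: quartic_inv_shift *)
qed

lemma quartic_equiv_swap:
  assumes "quartic_equiv Q (a, b, c, d, e) p q r s"
  shows "quartic_equiv Q (e, -d, c, -b, a) q (- p) s (- r)"
proof -
  obtain a0 b0 c0 d0 e0 where Q: "Q = (a0, b0, c0, d0, e0)" by (metis prod_cases5)
  have *: "p * (- z) + q * x = q * x + (- p) * z" for p q x z :: int by algebra
  have "q * (- r) - (- p) * s = p * s - q * r" by algebra
  then show ?thesis
    using assms unfolding Q quartic_equiv_def prod.case quartic_swap by (simp add: quartic_inv_swap *)
qed

lemma quartic_equiv_leading:
  assumes "quartic_equiv (a\<^sub>0, b\<^sub>0, c\<^sub>0, d\<^sub>0, e\<^sub>0) (a, b, c, d, e) p q r s"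
  shows "quartic a\<^sub>0 b\<^sub>0 c\<^sub>0 d\<^sub>0 e\<^sub>0 p r = a" "quartic_cov a\<^sub>0 b\<^sub>0 c\<^sub>0 d\<^sub>0 e\<^sub>0 p r = b\<^sup>2 - a * c"
proof -
  have "quartic a b c d e 1 0 = quartic a\<^sub>0 b\<^sub>0 c\<^sub>0 d\<^sub>0 e\<^sub>0 p r"
    "quartic_cov a b c d e 1 0 = quartic_cov a\<^sub>0 b\<^sub>0 c\<^sub>0 d\<^sub>0 e\<^sub>0 p r"
    using assms unfolding quartic_equiv_def prod.case by simp_all
  then show "quartic a\<^sub>0 b\<^sub>0 c\<^sub>0 d\<^sub>0 e\<^sub>0 p r = a" "quartic_cov a\<^sub>0 b\<^sub>0 c\<^sub>0 d\<^sub>0 e\<^sub>0 p r = b\<^sup>2 - a * c"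
    by (simp_all add: quartic_def quartic_cov_def)
qed

lemma quartic_equiv_small_vector:
  fixes \<alpha> \<beta> \<gamma> :: real
  assumes inv: "quartic_inv a\<^sub>0 b\<^sub>0 c\<^sub>0 d\<^sub>0 e\<^sub>0" and "\<alpha> > 0" and det: "\<alpha> * \<gamma> - \<beta>\<^sup>2 = 1"
  obtains a b c d e p q r s where "quartic_equiv (a\<^sub>0, b\<^sub>0, c\<^sub>0, d\<^sub>0, e\<^sub>0) (a, b, c, d, e) p q r s"
    "\<alpha> * (of_int p)\<^sup>2 + 2 * \<beta> * of_int p * of_int r + \<gamma> * (of_int r)\<^sup>2 > 0"
    "(\<alpha> * (of_int p)\<^sup>2 + 2 * \<beta> * of_int p * of_int r + \<gamma> * (of_int r)\<^sup>2)\<^sup>2 \<le> 4 / 3"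
proof -
  let ?Q = "(a\<^sub>0, b\<^sub>0, c\<^sub>0, d\<^sub>0, e\<^sub>0)"
  define \<phi> where "\<phi> = (\<lambda>v. \<alpha> * (of_int (fst v))\<^sup>2 + 2 * \<beta> * of_int (fst v) * of_int (snd v) + \<gamma> * (of_int (snd v))\<^sup>2)"
  define V where "V = {(p, r). \<exists>a b c d e q s. quartic_equiv ?Q (a, b, c, d, e) p q r s}"
  have "(1, 0) \<in> V" using quartic_equiv_refl[OF inv] unfolding V_def by blast
  then obtain v where v: "v \<in> V" "\<And>w. w \<in> V \<Longrightarrow> \<phi> v \<le> \<phi> w"
    using binary_form_minimal_vector[OF \<open>\<alpha> > 0\<close> det] unfolding \<phi>_def by blast
  obtain p r where pr: "v = (p, r)" by fastforce
  obtain a b c d e q s where eqv: "quartic_equiv ?Q (a, b, c, d, e) p q r s"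
    using v(1) unfolding V_def pr by blast
  define A where "A = \<phi> (p, r)"
  have dt: "p * s - q * r = 1" using eqv by (simp add: quartic_equiv_def)
  then have dtr: "of_int p * of_int s - of_int q * of_int r = (1::real)"
    by (metis of_int_1 of_int_diff of_int_mult)
  have "A > 0"
  proof -
    have "\<alpha> * A = (\<alpha> * p + \<beta> * r)\<^sup>2 + (real_of_int r)\<^sup>2"
      using det unfolding \<phi>_def A_def fst_conv snd_conv by algebra
    moreover have "(\<alpha> * p + \<beta> * r)\<^sup>2 + (real_of_int r)\<^sup>2 > 0"
    proof (cases "r = 0")
      case True
      then have "p \<noteq> 0" using dt by auto
      then show ?thesis using True \<open>\<alpha> > 0\<close> by simp
    next
      case False
      then show ?thesis by (simp add: add_nonneg_pos)
    qed
    ultimately show ?thesis using \<open>\<alpha> > 0\<close> by (metis zero_less_mult_pos)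
  qed
  define B where "B = \<alpha> * p * q + \<beta> * (p * s + q * r) + \<gamma> * r * s"
  define k where "k = - round (B / A)"
  define w where "w = (q + k * p, s + k * r)"
  have "w \<in> V"
  proof -
    obtain c' d' e' where "quartic_equiv ?Q (a, b + k * a, c', d', e') p (q + k * p) r (s + k * r)"
      using quartic_equiv_shift[OF eqv] by blast
    from quartic_equiv_swap[OF this] show ?thesis unfolding V_def w_def by blast
  qed
  then have "A \<le> \<phi> w" using v(2) unfolding A_def pr by blast
  have gram: "A * \<phi> w - (B + k * A)\<^sup>2 = 1"
  proof -
    have "A * \<phi> w - (B + k * A)\<^sup>2 = (\<alpha> * \<gamma> - \<beta>\<^sup>2) * (of_int p * of_int s - of_int q * of_int r)\<^sup>2"
      unfolding A_def B_def w_def \<phi>_def by (simp, algebra)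
    then show ?thesis unfolding det dtr by simp
  qed
  have "\<bar>B / A + k\<bar> \<le> 1 / 2"
    using of_int_round_abs_le[of "B / A"] unfolding k_def by (simp add: abs_minus_commute)
  then have "\<bar>B / A + k\<bar> * A \<le> 1 / 2 * A" using \<open>A > 0\<close> by (intro mult_right_mono) auto
  moreover have "\<bar>B / A + k\<bar> * A = \<bar>B + k * A\<bar>"
    using \<open>A > 0\<close> by (simp add: abs_if field_simps)
  ultimately have "\<bar>B + k * A\<bar> \<le> \<bar>A / 2\<bar>" using \<open>A > 0\<close> by simp
  then have "(B + k * A)\<^sup>2 \<le> (A / 2)\<^sup>2" by (simp only: abs_le_square_iff)
  moreover have "A * A \<le> A * \<phi> w" using \<open>A \<le> \<phi> w\<close> \<open>A > 0\<close> by simp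
  ultimately have "A\<^sup>2 \<le> 4 / 3" using gram by (simp add: power2_eq_square)
  then show ?thesis using that[OF eqv] \<open>A > 0\<close> unfolding A_def \<phi>_def by simp
qed

lemma small_squares_int:
  fixes j k :: int
  assumes "j\<^sup>2 = k" "k \<le> 255"
  shows "k \<in> {0, 1, 4, 9, 16, 25, 36, 49, 64, 81, 100, 121, 144, 169, 196, 225}"
proof -
  have "\<bar>j\<bar> < 16"
  proof (rule ccontr)
    assume "\<not> \<bar>j\<bar> < 16"
    then have "16\<^sup>2 \<le> \<bar>j\<bar>\<^sup>2" by (intro power_mono) auto
    then show False using assms by simp
  qed
  moreover have "k = \<bar>j\<bar>\<^sup>2" using assms by simp
  moreover obtain i where "\<bar>j\<bar> = int i" by (metis abs_ge_zero nonneg_int_cases)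
  ultimately have "i < 16" "k = int i ^ 2" by auto
  then have "i \<in> {0,1,2,3,4,5,6,7,8,9,10,11,12,13,14,15}" by (simp add: numeral_eq_Suc less_Suc_eq)
  then show ?thesis using \<open>k = int i ^ 2\<close> by (elim insertE) auto
qed

lemma covariant_bounds:
  fixes a n q \<phi> \<kappa> :: real
  assumes "\<phi> > 0" "\<phi>\<^sup>2 \<le> 4 / 3" and k: "4 * \<kappa>^3 + 4 * \<kappa>\<^sup>2 = 1" "0.4196 \<le> \<kappa>" "\<kappa> \<le> 0.4197"
    and a: "a = \<phi> * q" and n: "4 * n = 4 * \<kappa> * (\<kappa> + 1) * \<phi>\<^sup>2 - (q - (\<kappa> + 1) * \<phi>)\<^sup>2"
    and syz: "4 * n^3 - 4 * a * n\<^sup>2 + a^3 \<ge> 0"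
  shows "n < 1" "n + \<kappa> * a \<ge> 0" "a < 7"
proof -
  have kk: "\<kappa> * (\<kappa> + 1) \<le> 0.4197 * (0.4197 + 1)" using k by (intro mult_mono) auto
  have "\<kappa> * (\<kappa> + 1) * \<phi>\<^sup>2 \<le> (0.4197 * (0.4197 + 1)) * (4 / 3)"
    using kk assms(2) k by (intro mult_mono) auto
  then have "\<kappa> * (\<kappa> + 1) * \<phi>\<^sup>2 < 1" by simp
  moreover have "4 * \<kappa> * (\<kappa> + 1) * \<phi>\<^sup>2 = 4 * (\<kappa> * (\<kappa> + 1) * \<phi>\<^sup>2)" by simp
  ultimately show "n < 1" using n zero_le_power2[of "q - (\<kappa> + 1) * \<phi>"] by linarith
  define P where "P = (2 * n - (1 + \<kappa>) * a)\<^sup>2 + (1 + \<kappa>) * (3 * \<kappa> - 1) * a\<^sup>2"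
  have c: "(1 + \<kappa>) * (3 * \<kappa> - 1) > 0" using k by simp
  have "P \<ge> 0" using c by (simp add: P_def)
  have nP: "(n + \<kappa> * a) * P \<ge> 0" using syz cubic_factor[OF k(1), of n a] by (simp add: P_def)
  show nk: "n + \<kappa> * a \<ge> 0"
  proof (cases "P = 0")
    case True
    then have "(1 + \<kappa>) * (3 * \<kappa> - 1) * a\<^sup>2 = 0" "(2 * n - (1 + \<kappa>) * a)\<^sup>2 = 0"
      using c unfolding P_def by (smt (verit) mult_nonneg_nonneg zero_le_power2)+
    then have "a = 0" "n = 0" using c by auto
    then show ?thesis by simp
  next
    case False
    then show ?thesis using nP \<open>P \<ge> 0\<close> by (metis less_eq_real_def mult_le_0_iff not_less zero_le_mult_iff)
  qed
  show "a < 7"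
  proof (rule ccontr)
    assume "\<not> a < 7"
    then have a7: "a \<ge> 7" by simp
    have W: "(3 * \<kappa> - 1) * (\<kappa> + 1) \<le> 0.37"
    proof -
      have "(3 * \<kappa> - 1) * (\<kappa> + 1) \<le> (3 * 0.4197 - 1) * (0.4197 + 1)" using k by (intro mult_mono) auto
      then show ?thesis by simp
    qed
    have "\<phi>\<^sup>2 * (4 * (n + \<kappa> * a)) \<ge> 0" using nk by simp
    also have "\<phi>\<^sup>2 * (4 * (n + \<kappa> * a)) = (3 * \<kappa> - 1) * (\<kappa> + 1) * (\<phi>\<^sup>2 * \<phi>\<^sup>2) + (6 * \<kappa> + 2) * \<phi>\<^sup>2 * a - a\<^sup>2"
      using n unfolding a by algebra
    finally have "a\<^sup>2 \<le> (3 * \<kappa> - 1) * (\<kappa> + 1) * (\<phi>\<^sup>2 * \<phi>\<^sup>2) + (6 * \<kappa> + 2) * \<phi>\<^sup>2 * a" by simp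
    also have "(3 * \<kappa> - 1) * (\<kappa> + 1) * (\<phi>\<^sup>2 * \<phi>\<^sup>2) \<le> 0.37 * (4/3 * (4/3))"
      using W assms(2) k by (intro mult_mono) auto
    also have "(6 * \<kappa> + 2) * \<phi>\<^sup>2 * a \<le> (6 * 0.4197 + 2) * (4/3) * a"
      using assms(2) k a7 by (intro mult_mono) auto
    finally have "a * a \<le> 148 / 225 + 22591 / 3750 * a" by (simp add: power2_eq_square)
    moreover have "7 * a \<le> a * a" using a7 by (intro mult_right_mono) auto
    ultimately show False using a7 by linarith
  qed
qed

text \<open>These are the possible values of \<open>quartic_cov\<close> and \<open>quartic\<close> at a minimal vector of the definite
  factor.\<close>

lemma covariant_values:
  fixes a n j :: int
  assumes syz: "j\<^sup>2 = 4 * n^3 - 4 * a * n\<^sup>2 + a^3" and "n \<le> 0" "0 \<le> a" "a \<le> 6"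
  shows "n = 0 \<and> a \<in> {0, 1, 4}"
proof -
  have "a \<in> {0, 1, 2, 3, 4, 5, 6}" using assms by auto
  have "n \<ge> -2"
  proof (rule ccontr)
    assume "\<not> n \<ge> -2"
    then have n3: "n \<le> -3" by simp
    then have n9: "9 \<le> n\<^sup>2" using power_mono[of 3 "-n" 2] by simp
    have "4 * n^3 - 4 * a * n\<^sup>2 = 4 * (n - a) * n\<^sup>2" by algebra
    also have "\<dots> \<le> 4 * (n - a) * 9" using n9 n3 assms by (intro mult_left_mono_neg) auto
    also have "\<dots> \<le> - 108 - 36 * a" using n3 by simp
    finally have "j\<^sup>2 \<le> - 108 - 36 * a + a^3" using syz by simp
    moreover have "- 108 - 36 * a + a^3 < 0" using \<open>a \<in> _\<close> by auto
    ultimately show False using zero_le_power2[of j] by linarith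
  qed
  then have "n \<in> {0, -1, -2}" using assms by auto
  define k where "k = 4 * n^3 - 4 * a * n\<^sup>2 + a^3"
  have "k \<le> 255" using \<open>n \<in> _\<close> \<open>a \<in> _\<close> unfolding k_def by auto
  from small_squares_int[OF syz[folded k_def] this] show ?thesis
    using \<open>n \<in> _\<close> \<open>a \<in> _\<close> unfolding k_def by auto
qed

lemma quartic_inv_of_int:
  fixes a b c d e :: int
  assumes "quartic_inv a b c d e"
  shows "quartic_inv (of_int a :: real) (of_int b) (of_int c) (of_int d) (of_int e)"
proof -
  let ?I = "a * e - 4 * b * d + 3 * c\<^sup>2 + 2 * c"
  let ?J = "a * c * e + 2 * b * c * d - a * d\<^sup>2 - e * b\<^sup>2 - c^3 + 2 * b * d - 2 * c\<^sup>2 - c + 1"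
  have "real_of_int ?I = 1" "real_of_int ?J = 0" using assms unfolding quartic_inv_def by simp_all
  then show ?thesis unfolding quartic_inv_def by simp
qed

theorem quartic_normal_form:
  fixes a b c d e :: int
  assumes inv: "quartic_inv a b c d e" and "a > 0" and j0: "a\<^sup>2 * d - a * b - b^3 + 3 * b * (b\<^sup>2 - a * c) \<noteq> 0"
  obtains p q r s \<delta> where "quartic_equiv (a, b, c, d, e) (1, 0, 0, \<delta>, 1) p q r s" "\<delta>\<^sup>2 = 1"
proof -
  obtain \<kappa> :: real where k: "4 * \<kappa>^3 + 4 * \<kappa>\<^sup>2 = 1" "0.4196 \<le> \<kappa>" "\<kappa> \<le> 0.4197" by (rule covariant_cubic_root)
  define n where "n = b\<^sup>2 - a * c"
  define j where "j = a\<^sup>2 * d - a * b - b^3 + 3 * b * n"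
  have syz: "j\<^sup>2 = 4 * n^3 - 4 * a * n\<^sup>2 + a^3" using quartic_inv_syzygy[OF inv n_def j_def] .
  have rinv: "quartic_inv (real_of_int a) b c d e"
    using inv by (rule quartic_inv_of_int)
  have rn: "real_of_int n = (of_int b)\<^sup>2 - of_int a * of_int c" by (simp add: n_def)
  have rj: "real_of_int j = (of_int a)\<^sup>2 * of_int d - of_int a * of_int b - (of_int b)^3 + 3 * of_int b * of_int n"
    by (simp add: j_def)
  have rsyz: "(real_of_int j)\<^sup>2 = 4 * (of_int n)^3 - 4 * of_int a * (of_int n)\<^sup>2 + (of_int a)^3"
    using arg_cong[OF syz, of real_of_int] by simp
  have "j \<noteq> 0" using j0 by (simp only: j_def n_def not_False_eq_True)
  then have "real_of_int a > 0" "real_of_int j \<noteq> 0" "\<kappa> > 1/3" using \<open>a > 0\<close> k by auto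
  from definite_covariant[OF rinv rn rj rsyz this(1,2) k(1) this(3)]
  obtain \<alpha> \<beta> \<gamma> where \<phi>: "\<alpha> > 0" "\<alpha> * \<gamma> - \<beta>\<^sup>2 = 1"
    "\<And>x z. \<exists>q. quartic a b c d (real_of_int e) x z = (\<alpha> * x\<^sup>2 + 2 * \<beta> * x * z + \<gamma> * z\<^sup>2) * q \<and>
        4 * quartic_cov a b c d (real_of_int e) x z = 4 * \<kappa> * (\<kappa> + 1) * (\<alpha> * x\<^sup>2 + 2 * \<beta> * x * z + \<gamma> * z\<^sup>2)\<^sup>2
          - (q - (\<kappa> + 1) * (\<alpha> * x\<^sup>2 + 2 * \<beta> * x * z + \<gamma> * z\<^sup>2))\<^sup>2" by metis
  obtain a' b' c' d' e' p q r s where eqv: "quartic_equiv (a, b, c, d, e) (a', b', c', d', e') p q r s"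
    and small: "\<alpha> * (of_int p)\<^sup>2 + 2 * \<beta> * of_int p * of_int r + \<gamma> * (of_int r)\<^sup>2 > 0"
      "(\<alpha> * (of_int p)\<^sup>2 + 2 * \<beta> * of_int p * of_int r + \<gamma> * (of_int r)\<^sup>2)\<^sup>2 \<le> 4 / 3"
    using quartic_equiv_small_vector[OF inv \<phi>(1,2)] by metis
  define n' where "n' = b'\<^sup>2 - a' * c'"
  define j' where "j' = a'\<^sup>2 * d' - a' * b' - b'^3 + 3 * b' * n'"
  have inv': "quartic_inv a' b' c' d' e'" using eqv by (simp add: quartic_equiv_def)
  have syz': "j'\<^sup>2 = 4 * n'^3 - 4 * a' * n'\<^sup>2 + a'^3" using quartic_inv_syzygy[OF inv' n'_def j'_def] .
  have ra: "quartic (real_of_int a) b c d e p r = a'"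
    unfolding quartic_equiv_leading(1)[OF eqv, symmetric] by (simp add: quartic_def)
  have rn': "quartic_cov (real_of_int a) b c d e p r = n'"
    unfolding n'_def quartic_equiv_leading(2)[OF eqv, symmetric] by (simp add: quartic_cov_def)
  have rsyz': "4 * (real_of_int n')^3 - 4 * of_int a' * (real_of_int n')\<^sup>2 + (real_of_int a')^3 \<ge> 0"
  proof -
    have "0 \<le> real_of_int (j'\<^sup>2)" by simp
    then show ?thesis unfolding syz' by simp
  qed
  obtain t where "real_of_int a' = (\<alpha> * (of_int p)\<^sup>2 + 2 * \<beta> * of_int p * of_int r + \<gamma> * (of_int r)\<^sup>2) * t"
     "4 * real_of_int n' = 4 * \<kappa> * (\<kappa> + 1) * (\<alpha> * (of_int p)\<^sup>2 + 2 * \<beta> * of_int p * of_int r + \<gamma> * (of_int r)\<^sup>2)\<^sup>2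
          - (t - (\<kappa> + 1) * (\<alpha> * (of_int p)\<^sup>2 + 2 * \<beta> * of_int p * of_int r + \<gamma> * (of_int r)\<^sup>2))\<^sup>2"
    using \<phi>(3)[of p r] unfolding ra rn' by blast
  from covariant_bounds[OF small k this rsyz']
  have bd: "real_of_int n' < 1" "real_of_int n' + \<kappa> * of_int a' \<ge> 0" "real_of_int a' < 7" .
  have "n' \<le> 0" using bd(1) by linarith
  moreover have "a' \<ge> 0"
  proof (rule ccontr)
    assume "\<not> a' \<ge> 0"
    then have "\<kappa> * of_int a' < 0" using k by (simp add: mult_less_0_iff)
    then show False using bd(2) \<open>n' \<le> 0\<close> by linarith
  qed
  moreover have "a' \<le> 6" using bd(3) by linarith
  ultimately have na: "n' = 0" "a' \<in> {0, 1, 4}" using covariant_values[OF syz'] by auto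
  have bac: "b'\<^sup>2 = a' * c'" using na(1) by (simp add: n'_def)
  have j3: "j'\<^sup>2 = a'^3" using syz' na(1) by simp
  have "a' \<noteq> 0"
  proof
    assume "a' = 0"
    with bac have "b' = 0" by simp
    have "3 * c'\<^sup>2 + 2 * c' = 1" "- (c'^3) - 2 * c'\<^sup>2 - c' + 1 = 0"
      using inv' \<open>a' = 0\<close> \<open>b' = 0\<close> by (simp_all add: quartic_inv_def)
    then show False by algebra
  qed
  moreover have "a' \<noteq> 4"
  proof
    assume a4: "a' = 4"
    then have "even (b'\<^sup>2)" using bac by simp
    then obtain \<beta>' where b': "b' = 2 * \<beta>'" by auto
    have "\<bar>j'\<bar>\<^sup>2 = 8\<^sup>2" using j3 a4 by simp
    then have "\<bar>j'\<bar> = 8" by (metis abs_ge_zero power2_eq_imp_eq zero_le_numeral)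
    moreover have "16 * d' = j' + 8 * (\<beta>' + \<beta>'^3)"
      using j'_def na(1) a4 b' by (simp add: power3_eq_cube)
    moreover have "even (\<beta>' + \<beta>'^3)" by simp
    then obtain m where "\<beta>' + \<beta>'^3 = 2 * m" by blast
    ultimately show False by presburger
  qed
  ultimately have a1: "a' = 1" using na(2) by auto
  obtain c1 d1 e1 where eq1: "quartic_equiv (a, b, c, d, e) (1, 0, c1, d1, e1) p (q - b' * p) r (s - b' * r)"
    using quartic_equiv_shift[OF eqv, of "- b'"] a1 by auto
  have "c1 = 0" using quartic_equiv_leading(2)[OF eqv] quartic_equiv_leading(2)[OF eq1] na(1) by (simp add: n'_def)
  have inv1: "quartic_inv 1 0 c1 d1 e1" using eq1 by (simp add: quartic_equiv_def)
  have "e1 = 1" "d1\<^sup>2 = 1" using inv1 \<open>c1 = 0\<close> by (auto simp: quartic_inv_def)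
  then show ?thesis using eq1 \<open>c1 = 0\<close> that by blast
qed

section \<open>Rational points of the first curve\<close>

lemma mult_cubic_form_square:
  fixes k x w :: int
  assumes cop: "coprime k x" and "k \<noteq> 0" and eq: "k * (k^3 - 4 * k * x\<^sup>2 + 4 * x^3) = w\<^sup>2"
  obtains \<sigma> e j where "\<bar>\<sigma>\<bar> = 1" "k = \<sigma> * e\<^sup>2" "k^3 - 4 * k * x\<^sup>2 + 4 * x^3 = \<sigma> * j\<^sup>2"
proof -
  define h where "h = k^3 - 4 * k * x\<^sup>2 + 4 * x^3"
  have kh: "k * h = w\<^sup>2" using eq by (simp add: h_def)
  have copx: "coprime c (x^3)" if "c dvd k" for c
    using cop that by (metis coprime_divisors coprime_power_right_iff dvd_refl)
  obtain p q where p: "\<bar>k\<bar> = p\<^sup>2" and q: "\<bar>h\<bar> = q\<^sup>2"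
  proof (cases "even k")
    case False
    have "coprime k h"
    proof (rule coprimeI)
      fix c assume c: "c dvd k" "c dvd h"
      have "odd c" using c(1) False by (metis dvd_trans)
      have "2\<^sup>2 * x^3 = h - k * (k\<^sup>2 - 4 * x\<^sup>2)" unfolding h_def by algebra
      then have "c dvd 2\<^sup>2 * x^3" using c by (metis dvd_diff dvd_mult2)
      moreover have "coprime c (2\<^sup>2)" using \<open>odd c\<close>
        by (simp only: coprime_power_right_iff coprime_right_2_iff_odd) simp
      ultimately have "c dvd x^3" by (metis coprime_dvd_mult_right_iff)
      then show "is_unit c" using copx[OF c(1)] by (metis coprime_common_divisor dvd_refl)
    qed
    then show ?thesis using coprime_mult_eq_unit_square[of k h 1 w] kh that by auto
  next
    case True
    then obtain l where l: "k = 2 * l" by blast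
    define h' where "h' = 2 * l^3 - 2 * l * x\<^sup>2 + x^3"
    have hh: "h = 2\<^sup>2 * h'" unfolding h_def h'_def l by algebra
    have "odd x" using cop True by (metis coprime_common_divisor odd_one)
    then have "odd h'" by (simp add: h'_def)
    have "even (w\<^sup>2)" unfolding kh[symmetric] using True by simp
    then obtain v where "w = 2 * v" by auto
    then have kh': "k * h' = v\<^sup>2" using kh unfolding hh by (simp add: power_mult_distrib)
    have "coprime k h'"
    proof (rule coprimeI)
      fix c assume c: "c dvd k" "c dvd h'"
      have "odd c" using c(2) \<open>odd h'\<close> by (metis dvd_trans)
      then have "c dvd l" using c(1) unfolding l by (metis coprime_dvd_mult_right_iff coprime_right_2_iff_odd)
      have "x^3 = h' - l * (2 * l\<^sup>2 - 2 * x\<^sup>2)" unfolding h'_def by algebra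
      then have "c dvd x^3" using c(2) \<open>c dvd l\<close> by (metis dvd_diff dvd_mult2)
      then show "is_unit c" using copx[OF c(1)] by (metis coprime_common_divisor dvd_refl)
    qed
    then obtain p q where "\<bar>k\<bar> = p\<^sup>2" "\<bar>h'\<bar> = q\<^sup>2"
      using coprime_mult_eq_unit_square[of k h' 1 v] kh' by auto
    then have "\<bar>k\<bar> = p\<^sup>2" "\<bar>h\<bar> = (2 * q)\<^sup>2" by (simp_all add: hh abs_mult power_mult_distrib)
    then show ?thesis by (rule that)
  qed
  have "k * h \<ge> 0" using kh by simp
  then have "h = sgn k * \<bar>h\<bar>" using \<open>k \<noteq> 0\<close> by (auto simp: sgn_if zero_le_mult_iff)
  moreover have "k = sgn k * \<bar>k\<bar>" by (simp add: sgn_mult_abs)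
  moreover have "\<bar>sgn k\<bar> = 1" using \<open>k \<noteq> 0\<close> by simp
  ultimately show ?thesis using that p q unfolding h_def by metis
qed

lemma cubic_int_nonzero:
  fixes e n :: int
  assumes "coprime e n"
  shows "e^6 - 4 * e\<^sup>2 * n\<^sup>2 + 4 * n^3 \<noteq> 0"
proof
  assume eq: "e^6 - 4 * e\<^sup>2 * n\<^sup>2 + 4 * n^3 = 0"
  then have "e^6 = 2 * (2 * (e\<^sup>2 * n\<^sup>2 - n^3))" by simp
  then have "even (e^6)" by (metis dvd_triv_left)
  then obtain f where f: "e = 2 * f" by auto
  have "4 * n^3 = 4 * (2 * (2 * f\<^sup>2 * n\<^sup>2 - 8 * f^6))" using eq unfolding f by algebra
  then have "n^3 = 2 * (2 * f\<^sup>2 * n\<^sup>2 - 8 * f^6)" by simp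
  then have "even (n^3)" by (metis dvd_triv_left)
  then show False using assms f by (metis coprime_common_divisor dvd_triv_left even_power odd_one)
qed

lemma cubic_square_descent:
  fixes e n j :: int
  assumes "e > 0" and cop: "coprime e n" and eq: "j\<^sup>2 = e^6 - 4 * e\<^sup>2 * n\<^sup>2 + 4 * n^3" and nt: "n \<noteq> 0" "n \<noteq> e\<^sup>2"
  obtains e' n' j' :: int where "e' > 0" "coprime e' n'" "j'\<^sup>2 = e'^6 - 4 * e'\<^sup>2 * n'\<^sup>2 + 4 * n'^3"
    "n' \<noteq> 0" "n' \<noteq> e'\<^sup>2" "e = e' * \<bar>j'\<bar>" "n = n'^4 - 2 * n' * e'^6 + e'^8"
proof -
  obtain b c d k where q: "quartic_inv (e\<^sup>2) b c d k" "n = b\<^sup>2 - e\<^sup>2 * c" "j = e^4 * d - e\<^sup>2 * b - b^3 + 3 * b * n"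
    using covering_quartic[OF cop _ eq] \<open>e > 0\<close> by (metis less_irrefl)
  have "j \<noteq> 0" using cubic_int_nonzero[OF cop] eq by auto
  then have "(e\<^sup>2)\<^sup>2 * d - e\<^sup>2 * b - b^3 + 3 * b * (b\<^sup>2 - e\<^sup>2 * c) \<noteq> 0"
    using q(2,3) by simp
  then obtain p q' r s \<delta> where eqv: "quartic_equiv (e\<^sup>2, b, c, d, k) (1, 0, 0, \<delta>, 1) p q' r s" and \<delta>: "\<delta>\<^sup>2 = 1"
    using quartic_normal_form[OF q(1)] \<open>e > 0\<close> by (metis zero_less_power)
  have det: "p * s - q' * r = 1" using eqv by (simp add: quartic_equiv_def)
  have "quartic 1 0 0 \<delta> 1 s (- r) = quartic (e\<^sup>2) b c d k (p * s + q' * (- r)) (r * s + s * (- r))"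
    and "quartic_cov 1 0 0 \<delta> 1 s (- r) = quartic_cov (e\<^sup>2) b c d k (p * s + q' * (- r)) (r * s + s * (- r))"
    using eqv unfolding quartic_equiv_def prod.case by blast+
  moreover have "p * s + q' * (- r) = 1" "r * s + s * (- r) = 0" using det by simp_all
  ultimately have e2: "e\<^sup>2 = quartic 1 0 0 \<delta> 1 s (- r)" and nn: "n = quartic_cov 1 0 0 \<delta> 1 s (- r)"
    unfolding q(2) by (simp_all add: quartic_def quartic_cov_def)
  define x where "x = s"
  define K where "K = s - \<delta> * r"
  have eK: "K * (K^3 - 4 * K * x\<^sup>2 + 4 * x^3) = e\<^sup>2"
    using \<delta> unfolding e2 quartic_def K_def x_def by algebra
  have nK: "n = x^4 - 2 * x * K^3 + K^4"
  proof -
    have "n = 2 * \<delta> * s^3 * r - 2 * \<delta> * s * r^3 + \<delta>\<^sup>2 * r^4" unfolding nn quartic_cov_def by simp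
    then show ?thesis using \<delta> unfolding K_def x_def by algebra
  qed
  have "coprime K x"
  proof (rule coprimeI)
    fix c assume c: "c dvd K" "c dvd x"
    have "\<delta> * (\<delta> * r) = r" using \<delta> by (simp add: power2_eq_square mult.assoc[symmetric])
    moreover have "c dvd \<delta> * r" using dvd_diff[OF c(2,1)] by (simp add: K_def x_def)
    ultimately have "c dvd r" by (metis dvd_mult)
    then have "c dvd p * s - q' * r" using c(2) by (simp add: x_def)
    then show "is_unit c" using det by simp
  qed
  have "K \<noteq> 0" using eK \<open>e > 0\<close> by auto
  obtain \<sigma> e' j' where s: "\<bar>\<sigma>\<bar> = 1" "K = \<sigma> * e'\<^sup>2" "K^3 - 4 * K * x\<^sup>2 + 4 * x^3 = \<sigma> * j'\<^sup>2"
    using mult_cubic_form_square[OF \<open>coprime K x\<close> \<open>K \<noteq> 0\<close> eK] by blast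
  have \<sigma>2: "\<sigma>\<^sup>2 = 1" using s(1) by (metis power2_abs power_one)
  define n' where "n' = \<sigma> * x"
  define E where "E = \<bar>e'\<bar>"
  have "e' \<noteq> 0" using s(2) \<open>K \<noteq> 0\<close> by auto
  then have "E > 0" by (simp add: E_def)
  have E2: "e'\<^sup>2 = E\<^sup>2" by (simp add: E_def)
  have cE: "coprime E n'"
  proof -
    have "coprime (e'\<^sup>2) x" using \<open>coprime K x\<close> s(2) by simp
    moreover have "is_unit \<sigma>" using s(1) by simp
    ultimately show ?thesis unfolding E_def n'_def
      by (simp add: is_unit_right_imp_coprime)
  qed
  have j': "j'\<^sup>2 = E^6 - 4 * E\<^sup>2 * n'\<^sup>2 + 4 * n'^3"
    using s(3) \<sigma>2 unfolding s(2) n'_def E2 by algebra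
  have "e\<^sup>2 = (E * j')\<^sup>2"
    using eK \<sigma>2 unfolding s(3) unfolding s(2) E2 by algebra
  then have "e\<^sup>2 = (E * \<bar>j'\<bar>)\<^sup>2" by (simp add: power_mult_distrib)
  then have e: "e = E * \<bar>j'\<bar>" using \<open>e > 0\<close> \<open>E > 0\<close> by (simp add: power2_eq_iff_nonneg)
  have n: "n = n'^4 - 2 * n' * E^6 + E^8"
    using nK \<sigma>2 unfolding s(2) n'_def E2 by algebra
  have "n' \<noteq> 0"
  proof
    assume "n' = 0"
    then have "E = 1" using cE \<open>E > 0\<close> by simp
    then have "\<bar>j'\<bar>\<^sup>2 = 1" using j' \<open>n' = 0\<close> by simp
    then have "e\<^sup>2 = 1" using e \<open>E = 1\<close> by (simp add: power_mult_distrib)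
    then show False using nt n \<open>n' = 0\<close> \<open>E = 1\<close> by simp
  qed
  moreover have "n' \<noteq> E\<^sup>2"
  proof
    assume "n' = E\<^sup>2"
    then have "E = 1" using cE \<open>E > 0\<close> by simp
    then show False using nt n \<open>n' = E\<^sup>2\<close> by simp
  qed
  ultimately show ?thesis using that[OF \<open>E > 0\<close> cE j' _ _ e n] by blast
qed

text \<open>The descent replaces \<open>e\<close> by a proper divisor unless \<open>j' = \<plusminus>1\<close>; this bound shows that the exceptional
  case cannot occur twice in a row.\<close>

lemma cubic_square_one_bound:
  fixes e n :: int
  assumes "e > 0" and eq: "1 = e^6 - 4 * e\<^sup>2 * n\<^sup>2 + 4 * n^3" and nt: "n \<noteq> 0" "n \<noteq> e\<^sup>2"
  shows "n < 0"
proof (rule ccontr)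
  assume "\<not> n < 0"
  then have "n > 0" using nt by simp
  define a where "a = e\<^sup>2"
  have eq': "4 * n\<^sup>2 * (a - n) = a^3 - 1" using eq unfolding a_def by algebra
  have "a \<ge> 1" unfolding a_def using \<open>e > 0\<close> by (metis int_one_le_iff_zero_less zero_less_power)
  show False
  proof (cases "a = 1")
    case True
    then show False using eq' nt by (auto simp: a_def)
  next
    case False
    then have "a \<ge> 2" using \<open>a \<ge> 1\<close> by simp
    have "27 * n\<^sup>2 * (a - n) \<le> 4 * a^3"
    proof -
      have "4 * a^3 - 27 * n\<^sup>2 * (a - n) = (3 * n - 2 * a)\<^sup>2 * (3 * n + a)" by algebra
      also have "\<dots> \<ge> 0" using \<open>n > 0\<close> \<open>a \<ge> 1\<close> by simp
      finally show ?thesis by simp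
    qed
    then have "27 * (a^3 - 1) \<le> 16 * a^3" using eq' by (simp add: algebra_simps)
    moreover have "2^3 \<le> a^3" using \<open>a \<ge> 2\<close> by (intro power_mono) auto
    ultimately show False by simp
  qed
qed

theorem cubic_square_int:
  fixes e n j :: int
  assumes "e > 0" "coprime e n" "j\<^sup>2 = e^6 - 4 * e\<^sup>2 * n\<^sup>2 + 4 * n^3"
  shows "n = 0 \<or> n = e\<^sup>2"
  using assms
proof (induction "nat e" arbitrary: e n j rule: less_induct)
  case less
  show ?case
  proof (rule ccontr)
    assume "\<not> ?thesis"
    then have nt: "n \<noteq> 0" "n \<noteq> e\<^sup>2" by auto
    have unit: "\<bar>j'\<bar> = 1 \<and> e' = e" if "e' > 0" "coprime e' n'" "j'\<^sup>2 = e'^6 - 4 * e'\<^sup>2 * n'\<^sup>2 + 4 * n'^3"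
      "n' \<noteq> 0" "n' \<noteq> e'\<^sup>2" "e = e' * \<bar>j'\<bar>" for e' n' j' :: int
    proof -
      have "\<not> e' < e" using less.hyps[of e' n' j'] that by auto
      then have "e' * \<bar>j'\<bar> \<le> e' * 1" using that(6) by simp
      then have "\<bar>j'\<bar> \<le> 1" using \<open>e' > 0\<close> by simp
      moreover have "j' \<noteq> 0" using that(6) less.prems(1) by auto
      ultimately have "\<bar>j'\<bar> = 1" by simp
      then show ?thesis using that(6) by simp
    qed
    obtain e1 n1 j1 where 1: "e1 > 0" "coprime e1 n1" "j1\<^sup>2 = e1^6 - 4 * e1\<^sup>2 * n1\<^sup>2 + 4 * n1^3"
      "n1 \<noteq> 0" "n1 \<noteq> e1\<^sup>2" "e = e1 * \<bar>j1\<bar>"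
      using cubic_square_descent[OF less.prems nt] by metis
    have j1: "\<bar>j1\<bar> = 1" and e1: "e1 = e" using unit[OF 1] by auto
    obtain e2 n2 j2 where 2: "e2 > 0" "coprime e2 n2" "j2\<^sup>2 = e2^6 - 4 * e2\<^sup>2 * n2\<^sup>2 + 4 * n2^3"
      "n2 \<noteq> 0" "n2 \<noteq> e2\<^sup>2" "e1 = e2 * \<bar>j2\<bar>" and n1: "n1 = n2^4 - 2 * n2 * e2^6 + e2^8"
      using cubic_square_descent[OF 1(1-5)] by metis
    have j2: "\<bar>j2\<bar> = 1" using unit[OF 2(1-5)] 2(6) e1 by auto
    have "j1\<^sup>2 = 1" "j2\<^sup>2 = 1" using j1 j2 by (metis power2_abs power_one)+
    then have "n1 < 0" "n2 < 0"
      using cubic_square_one_bound[OF 1(1) _ 1(4,5)] cubic_square_one_bound[OF 2(1) _ 2(4,5)] 1(3) 2(3) by auto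
    have "n2 * e2^6 < 0" using \<open>n2 < 0\<close> 2(1) by (simp add: mult_less_0_iff)
    moreover have "n2^4 \<ge> 0" "e2^8 \<ge> 0" by simp_all
    ultimately have "n1 > 0" unfolding n1 by linarith
    with \<open>n1 < 0\<close> show False by simp
  qed
qed

theorem quartic_E1_rat:
  fixes t w :: rat
  assumes eq: "t^4 + 4 * t^3 + 2 * t\<^sup>2 + 1 = w\<^sup>2"
  shows "t = 0 \<or> t = -1"
proof (rule ccontr)
  assume nt: "\<not> ?thesis"
  obtain m l where ml: "quotient_of t = (m, l)" by fastforce
  have l: "l > 0" and cop: "coprime m l" and t: "t = of_int m / of_int l"
    using ml quotient_of_denom_pos quotient_of_coprime quotient_of_div by blast+
  define k where "k = m + l"
  have "of_int (k * (k^3 - 4 * k * l\<^sup>2 + 4 * l^3)) = (t^4 + 4 * t^3 + 2 * t\<^sup>2 + 1) * (of_int l ^ 4 :: rat)"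
    using l unfolding k_def t by (simp add: field_simps power2_eq_square power3_eq_cube power4_eq_xxxx)
  also have "\<dots> = (w * of_int l ^ 2)\<^sup>2" unfolding eq by (simp add: power_mult_distrib flip: power_mult)
  finally obtain z where z: "k * (k^3 - 4 * k * l\<^sup>2 + 4 * l^3) = z\<^sup>2"
    using rat_square_eq_of_int by metis
  have "coprime k l" using coprime_add_mult[OF cop] unfolding k_def coprime_mult_right_iff by blast
  have "k \<noteq> 0"
  proof
    assume "k = 0"
    then have "m = - l" by (simp add: k_def)
    then show False using nt l unfolding t by simp
  qed
  obtain \<sigma> e j where s: "\<bar>\<sigma>\<bar> = 1" "k = \<sigma> * e\<^sup>2" "k^3 - 4 * k * l\<^sup>2 + 4 * l^3 = \<sigma> * j\<^sup>2"
    using mult_cubic_form_square[OF \<open>coprime k l\<close> \<open>k \<noteq> 0\<close> z] by blast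
  have \<sigma>2: "\<sigma>\<^sup>2 = 1" using s(1) by (metis power2_abs power_one)
  have "e \<noteq> 0" using s(2) \<open>k \<noteq> 0\<close> by auto
  have "coprime (e\<^sup>2) l" using \<open>coprime k l\<close> s(2) by simp
  then have "coprime \<bar>e\<bar> (\<sigma> * l)" using s(1) by (simp add: is_unit_right_imp_coprime)
  moreover have "j\<^sup>2 = \<bar>e\<bar>^6 - 4 * \<bar>e\<bar>\<^sup>2 * (\<sigma> * l)\<^sup>2 + 4 * (\<sigma> * l)^3"
  proof -
    have "\<bar>e\<bar>^6 = e^6" by (simp add: power_even_abs)
    then show ?thesis using s(3) \<sigma>2 unfolding s(2) power2_abs by algebra
  qed
  ultimately have "\<sigma> * l = 0 \<or> \<sigma> * l = \<bar>e\<bar>\<^sup>2"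
    using cubic_square_int \<open>e \<noteq> 0\<close> by (metis zero_less_abs_iff)
  moreover have "\<sigma> * l \<noteq> 0" using s(1) l by auto
  ultimately have "\<sigma> * l = e\<^sup>2" by simp
  then have "k = l" using s(2) \<sigma>2 by (metis mult.assoc mult_1 power2_eq_square)
  then have "m = 0" by (simp add: k_def)
  then show False using nt t by simp
qed

section \<open>Quadratic points\<close>

lemma irrational_linear:
  fixes t :: "'a::field_char_0" and A B :: rat
  assumes "t \<notin> range of_rat" and "of_rat A + of_rat B * t = 0"
  shows "A = 0 \<and> B = 0"
proof -
  have "B = 0"
  proof (rule ccontr)
    assume "B \<noteq> 0"
    then have "t = - of_rat A / of_rat B" using assms(2) by (simp add: field_simps eq_neg_iff_add_eq_0)
    then have "t = of_rat (- A / B)" by (simp add: of_rat_divide of_rat_minus)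
    with assms(1) show False by blast
  qed
  with assms(2) show ?thesis by simp
qed

text \<open>If \<open>t\<close> is a root of \<open>T\<^sup>2 + u T + v\<close> and \<open>P t\<close> is the square of \<open>\<alpha> + \<beta> t\<close> for the quartic \<open>P\<close>, then
  \<open>P - (T\<^sup>2 + a T + b)\<^sup>2\<close> with \<open>a = u + \<beta>\<close> and \<open>b = v + \<alpha>\<close> is divisible by \<open>T\<^sup>2 + u T + v\<close>.\<close>

lemma quadratic_point_on_quartic:
  fixes t y :: "'a::field_char_0" and u v \<alpha> \<beta> k :: rat
  assumes t: "t \<notin> range of_rat" and q: "t\<^sup>2 + of_rat u * t + of_rat v = 0" and y: "y = of_rat \<alpha> + of_rat \<beta> * t"
    and eq: "y\<^sup>2 = t^4 + 4 * t^3 + 2 * t\<^sup>2 + of_rat k * t + 1"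
  obtains a b d :: rat where "2 - a\<^sup>2 - 2 * b = d + (4 - 2 * a) * u" "k - 2 * a * b = (4 - 2 * a) * v + d * u" "1 - b\<^sup>2 = d * v"
proof -
  define a where "a = u + \<beta>"
  define b where "b = v + \<alpha>"
  define d where "d = 2 - a\<^sup>2 - 2 * b - (4 - 2 * a) * u"
  define a' b' u' v' k' :: 'a where "a' = of_rat a" and "b' = of_rat b" and "u' = of_rat u" and "v' = of_rat v" and "k' = of_rat k"
  have "y = a' * t + b' + t\<^sup>2"
    using q unfolding y a'_def b'_def a_def b_def of_rat_add by algebra
  then have "(1 - b'\<^sup>2 - (2 - a'\<^sup>2 - 2 * b' - (4 - 2 * a') * u') * v')
    + (k' - 2 * a' * b' - (4 - 2 * a') * v' - (2 - a'\<^sup>2 - 2 * b' - (4 - 2 * a') * u') * u') * t = 0"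
    using q eq unfolding u'_def[symmetric] v'_def[symmetric] k'_def[symmetric] by algebra
  then have "of_rat (1 - b\<^sup>2 - d * v) + of_rat (k - 2 * a * b - (4 - 2 * a) * v - d * u) * t = 0"
    unfolding d_def a'_def b'_def u'_def v'_def k'_def
    by (simp add: of_rat_diff of_rat_mult of_rat_power)
  from irrational_linear[OF t this]
  have "1 - b\<^sup>2 = d * v" "k - 2 * a * b = (4 - 2 * a) * v + d * u" by auto
  then show ?thesis using that[of a b d] by (simp add: d_def)
qed

lemma quadratic_class_root:
  fixes u v a b d k s :: rat
  assumes "2 - a\<^sup>2 - 2 * b = d + (4 - 2 * a) * u" "k - 2 * a * b = (4 - 2 * a) * v + d * u" "1 - b\<^sup>2 = d * v"
    and "(4 - 2 * a) * s = - d"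
  shows "s^4 + 4 * s^3 + 2 * s\<^sup>2 + k * s + 1 = (s\<^sup>2 + a * s + b)\<^sup>2"
  using assms by algebra

lemma quadratic_class_E1:
  fixes u v a b d :: rat
  assumes E1: "\<And>t w :: rat. t^4 + 4 * t^3 + 2 * t\<^sup>2 + 1 = w\<^sup>2 \<Longrightarrow> t = 0 \<or> t = -1"
  assumes c: "2 - a\<^sup>2 - 2 * b = d + (4 - 2 * a) * u" "0 - 2 * a * b = (4 - 2 * a) * v + d * u" "1 - b\<^sup>2 = d * v"
  shows "(v + 1) * u = 2 * v + 1 \<or> (v - 1) * u = v\<^sup>2"
proof (cases "a = 2")
  case True
  have d: "d = - 2 - 2 * b" using c(1) True by simp
  have "b \<noteq> -1" using c(2) d True by auto
  have "(1 + b) * (1 - b + 2 * v) = 0" using c(3) unfolding d by algebra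
  then have b: "b = 1 + 2 * v" using \<open>b \<noteq> -1\<close> by (auto simp: add_eq_0_iff)
  have "(v + 1) * u = 2 * v + 1" using c(2) unfolding d True b by (simp add: algebra_simps)
  then show ?thesis ..
next
  case False
  define s where "s = - d / (4 - 2 * a)"
  have s: "(4 - 2 * a) * s = - d" using False by (simp add: s_def)
  have "s = 0 \<or> s = -1" using E1[of s "s\<^sup>2 + a * s + b"] quadratic_class_root[OF c s] by simp
  then consider "d = 0" | "d = 4 - 2 * a" using s by auto
  then show ?thesis
  proof cases
    case 1
    then have "b\<^sup>2 = 1" using c(3) by simp
    then consider "b = 1" | "b = -1" by (auto simp: power2_eq_1_iff)
    then show ?thesis
    proof cases
      case b: 1
      have e: "- a = (2 - a) * v" "2 * (2 - a) * u = - (a\<^sup>2)" using c 1 b by (auto simp: algebra_simps)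
      have "4 * ((v - 1) * u) = 4 * v\<^sup>2" using e by algebra
      then show ?thesis by simp
    next
      case b: 2
      have "(2 - a) * (2 * u) = (2 - a) * (2 + a)" using c(1) 1 b by (simp add: algebra_simps power2_eq_square)
      then have "2 * u = 2 + a" using False by simp
      moreover have "a = (2 - a) * v" using c(2) 1 b by (simp add: algebra_simps)
      ultimately have "2 * ((v + 1) * u) = 2 * (2 * v + 1)" by algebra
      then show ?thesis by simp
    qed
  next
    case 2
    have "(a - b - 1)\<^sup>2 = 0" using c unfolding 2 by algebra
    then have b: "b = a - 1" by simp
    have "(2 - a) * a = (2 - a) * (2 * v)" using c(3) unfolding 2 b by algebra
    then have a: "a = 2 * v" using False by simp
    have "(v - 1) * u = v\<^sup>2" using c(1) unfolding 2 b a by algebra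
    then show ?thesis ..
  qed
qed

lemma quadratic_class_E2:
  fixes u v a b d :: rat
  assumes c: "2 - a\<^sup>2 - 2 * b = d + (4 - 2 * a) * u" "4 - 2 * a * b = (4 - 2 * a) * v + d * u" "1 - b\<^sup>2 = d * v"
  shows "(v + 1) * u = 2 * v \<or> v = 1 \<and> (\<exists>w. 2 * (2 - w) * u = - (w\<^sup>2))"
proof (cases "a = 2")
  case True
  have d: "d = - 2 - 2 * b" using c(1) True by simp
  have "b \<noteq> -1" using c(2) d True by auto
  have "(1 + b) * (1 - b + 2 * v) = 0" using c(3) unfolding d by algebra
  then have b: "b = 1 + 2 * v" using \<open>b \<noteq> -1\<close> by (auto simp: add_eq_0_iff)
  have "(v + 1) * u = 2 * v" using c(2) unfolding d True b by (simp add: algebra_simps)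
  then show ?thesis ..
next
  case False
  define s where "s = - d / (4 - 2 * a)"
  have s: "(4 - 2 * a) * s = - d" using False by (simp add: s_def)
  have "s = 0" using quartic_E2_rat[of s 1 "s\<^sup>2 + a * s + b"] quadratic_class_root[OF c s]
    by (simp add: algebra_simps power2_eq_square power3_eq_cube power4_eq_xxxx)
  then have "d = 0" using s by auto
  then have "b\<^sup>2 = 1" using c(3) by simp
  then consider "b = 1" | "b = -1" by (auto simp: power2_eq_1_iff)
  then show ?thesis
  proof cases
    case b: 1
    have "(4 - 2 * a) * v = (4 - 2 * a) * 1" using c(2) \<open>d = 0\<close> b by simp
    then have "v = 1" using False by simp
    moreover have "2 * (2 - a) * u = - (a\<^sup>2)" using c(1) \<open>d = 0\<close> b by (simp add: algebra_simps)
    ultimately show ?thesis by blast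
  next
    case b: 2
    have "(2 - a) * (2 * u) = (2 - a) * (2 + a)" using c(1) \<open>d = 0\<close> b by (simp add: algebra_simps power2_eq_square)
    then have "2 * u = 2 + a" using False by simp
    moreover have "(2 - a) * v = 2 + a" using c(2) \<open>d = 0\<close> b by (simp add: algebra_simps)
    ultimately have "(v + 1) * u = 2 * v" by algebra
    then show ?thesis ..
  qed
qed

lemma quadratic_classes_disjoint:
  fixes u v :: rat
  assumes "v \<noteq> 0" and "(v + 1) * u = 2 * v + 1 \<or> (v - 1) * u = v\<^sup>2"
    and "(v + 1) * u = 2 * v \<or> v = 1 \<and> (\<exists>w. 2 * (2 - w) * u = - (w\<^sup>2))"
  shows False
proof -
  have False if "(v + 1) * u = 2 * v + 1" "v = 1" "2 * (2 - w) * u = - (w\<^sup>2)" for w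
  proof -
    have "u = 3 / 2" using that by simp
    with that(3) have "(2 * w - 3)\<^sup>2 + 15 = 0" by (simp add: algebra_simps power2_eq_square)
    then show False using zero_le_power2[of "2 * w - 3"] by linarith
  qed
  moreover have False if "(v - 1) * u = v\<^sup>2" "(v + 1) * u = 2 * v"
  proof -
    have "v * (v\<^sup>2 - v + 2) = 0" using that by algebra
    then have "v\<^sup>2 - v + 2 = 0" using \<open>v \<noteq> 0\<close> by (metis mult_eq_0_iff)
    then have "(2 * v - 1)\<^sup>2 + 7 = 0" by algebra
    then show False using zero_le_power2[of "2 * v - 1"] by linarith
  qed
  moreover have "\<not> ((v + 1) * u = 2 * v + 1 \<and> (v + 1) * u = 2 * v)" by linarith
  moreover have "\<not> ((v - 1) * u = v\<^sup>2 \<and> v = 1)" by auto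
  ultimately show False using assms(2,3) by blast
qed

lemma product_square_imp_E2_square:
  fixes m l z :: int
  defines "F \<equiv> m^4 + 4 * m^3 * l + 2 * m\<^sup>2 * l\<^sup>2 + l^4"
    and "G \<equiv> (m\<^sup>2 + l\<^sup>2) * (m\<^sup>2 + 4 * m * l + l\<^sup>2)"
  assumes cop: "coprime m l" and eq: "F * G = z\<^sup>2"
  obtains \<sigma> w where "\<bar>\<sigma>\<bar> = 1" "G = \<sigma> * w\<^sup>2"
proof -
  have GF: "G = F + 2\<^sup>2 * (m * l^3)" unfolding F_def G_def by algebra
  have c: "coprime F g" if "odd g" "g dvd G" for g
  proof (rule coprimeI)
    fix c assume c: "c dvd F" "c dvd g"
    have "odd c" using c(2) that(1) by (metis dvd_trans)
    have cG: "c dvd G" using c(2) that(2) by (metis dvd_trans)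
    have "c dvd 2\<^sup>2 * (m * l^3)" using cG c(1) GF by (metis dvd_add_right_iff)
    moreover have "coprime c (2\<^sup>2)" using \<open>odd c\<close>
      by (simp only: coprime_power_right_iff coprime_right_2_iff_odd) simp
    ultimately have "c dvd m * l^3" by (metis coprime_dvd_mult_right_iff)
    moreover have "(m * l)^3 = m\<^sup>2 * (m * l^3)" by algebra
    ultimately have "c dvd (m * l)^3" by (metis dvd_mult)
    moreover have "coprime G (m * l)"
    proof -
      have 1: "coprime (m\<^sup>2 + l\<^sup>2) (m * l)" using cop by (rule coprime_sum_squares)
      have "coprime (m\<^sup>2 + 4 * m * l + l\<^sup>2) (m * l)"
      proof (rule coprimeI)
        fix p assume p: "p dvd m\<^sup>2 + 4 * m * l + l\<^sup>2" "p dvd m * l"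
        have "m\<^sup>2 + l\<^sup>2 = (m\<^sup>2 + 4 * m * l + l\<^sup>2) - 4 * (m * l)" by simp
        then have "p dvd m\<^sup>2 + l\<^sup>2" using p by (metis dvd_diff dvd_mult)
        then show "is_unit p" using 1 p(2) by (metis coprime_common_divisor)
      qed
      with 1 show ?thesis by (simp add: G_def)
    qed
    then have "coprime c ((m * l)^3)" using cG by (metis coprime_divisors coprime_power_right_iff dvd_refl)
    ultimately show "is_unit c" by (metis coprime_common_divisor dvd_refl)
  qed
  obtain g h where g: "odd g" "G = h\<^sup>2 * g" "F * g = (if even G then z div 2 else z)\<^sup>2"
  proof (cases "even G")
    case False
    then show ?thesis using that[of G 1] eq by simp
  next
    case True
    then have "even m \<longleftrightarrow> even l" by (auto simp: G_def)
    then have "odd m" "odd l" using cop by (metis coprime_common_divisor odd_one)+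
    obtain p where p: "m = 2 * p + 1" using \<open>odd m\<close> by (rule oddE)
    obtain q where q: "l = 2 * q + 1" using \<open>odd l\<close> by (rule oddE)
    define g where "g = (2 * (p\<^sup>2 + p + q\<^sup>2 + q) + 1) * (2 * (p\<^sup>2 + p + q\<^sup>2 + q + 4 * p * q + 2 * p + 2 * q + 1) + 1)"
    have G: "G = 2\<^sup>2 * g" unfolding G_def g_def p q by algebra
    have "odd g" by (simp add: g_def)
    have "even (z\<^sup>2)" unfolding eq[symmetric] using True by simp
    then obtain y where y: "z = 2 * y" by auto
    have "F * g = y\<^sup>2" using eq unfolding G y by (simp add: power_mult_distrib)
    then show ?thesis using that[OF \<open>odd g\<close> G] True y by simp
  qed
  obtain w where "\<bar>g\<bar> = w\<^sup>2"
    using coprime_mult_eq_unit_square[OF c[OF g(1)], of 1] g by (metis abs_1 dvd_triv_right mult_1)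
  then have "g = sgn g * w\<^sup>2" by (metis sgn_mult_abs)
  then have "G = sgn g * (h * w)\<^sup>2" using g(2) by (metis mult.left_commute power_mult_distrib)
  moreover have "\<bar>sgn g\<bar> = 1" using \<open>odd g\<close> by (auto simp: abs_sgn_eq)
  ultimately show ?thesis using that by blast
qed

lemma quadratic_field_span:
  fixes K :: "'a::field_char_0 set"
  assumes K: "quadratic_field K" and x: "x \<in> K" "x \<notin> range of_rat" and y: "y \<in> K"
  obtains \<alpha> \<beta> :: rat where "y = of_rat \<alpha> + of_rat \<beta> * x"
proof -
  interpret V: vector_space "rat_scale :: rat \<Rightarrow> 'a \<Rightarrow> 'a" by (rule vector_space_rat_scale)
  have "V.dim K = 2" and "1 \<in> K" using K by (auto simp: quadratic_field_def subfield_set_def)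
  obtain B where B: "K \<subseteq> V.span B" "card B = 2"
    using V.basis_exists[of K] \<open>V.dim K = 2\<close> by metis
  obtain u v where uv: "B = {u, v}" using B(2) by (auto simp: card_2_iff)
  have comb: "\<exists>p q. w = of_rat p * u + of_rat q * v" if "w \<in> K" for w
  proof -
    have "w \<in> V.span {u, v}" using B(1) uv that by blast
    then obtain p where "w - rat_scale p u \<in> V.span {v}" using V.span_breakdown_eq by blast
    then obtain q where "w - rat_scale p u - rat_scale q v \<in> V.span {}" using V.span_breakdown_eq by blast
    then show ?thesis by (intro exI[of _ p] exI[of _ q]) (simp add: rat_scale_def algebra_simps)
  qed
  obtain p1 q1 where 1: "1 = of_rat p1 * u + of_rat q1 * v" using comb[OF \<open>1 \<in> K\<close>] by blast
  obtain p2 q2 where 2: "x = of_rat p2 * u + of_rat q2 * v" using comb[OF x(1)] by blast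
  obtain p3 q3 where 3: "y = of_rat p3 * u + of_rat q3 * v" using comb[OF y] by blast
  define D where "D = p1 * q2 - p2 * q1"
  have "D \<noteq> 0"
  proof
    assume "D = 0"
    then have D: "(of_rat p1 :: 'a) * of_rat q2 = of_rat p2 * of_rat q1"
      by (simp add: D_def flip: of_rat_mult)
    have "of_rat p2 + of_rat (- p1) * x = 0" "of_rat q2 + of_rat (- q1) * x = 0"
      using 1 2 D unfolding of_rat_minus by algebra+
    then have "p1 = 0" "q1 = 0" using irrational_linear[OF x(2)] by (metis neg_equal_0_iff_equal)+
    with 1 show False by simp
  qed
  have "of_rat D * y = of_rat (p3 * q2 - q3 * p2) + of_rat (q3 * p1 - p3 * q1) * x"
    using 1 2 3 unfolding D_def of_rat_diff of_rat_mult by algebra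
  then have "y = of_rat ((p3 * q2 - q3 * p2) / D) + of_rat ((q3 * p1 - p3 * q1) / D) * x"
    using \<open>D \<noteq> 0\<close> unfolding of_rat_divide by (simp add: field_simps)
  then show ?thesis by (rule that)
qed

lemma rational_point:
  fixes q \<beta> :: rat
  assumes eq: "q^4 + 4 * q^3 + 2 * q\<^sup>2 + 4 * q + 1 = \<beta>\<^sup>2 * (q^4 + 4 * q^3 + 2 * q\<^sup>2 + 1)"
  shows "q = 0 \<or> q = -1"
proof -
  obtain m l where ml: "quotient_of q = (m, l)" by fastforce
  have l: "l > 0" and cop: "coprime m l" and q: "q = of_int m / of_int l"
    using ml quotient_of_denom_pos quotient_of_coprime quotient_of_div by blast+
  let ?F = "m^4 + 4 * m^3 * l + 2 * m\<^sup>2 * l\<^sup>2 + l^4" and ?G = "(m\<^sup>2 + l\<^sup>2) * (m\<^sup>2 + 4 * m * l + l\<^sup>2)"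
  have mq: "of_int m = q * of_int l" using l q by simp
  have F: "of_int ?F = (q^4 + 4 * q^3 + 2 * q\<^sup>2 + 1) * of_int l ^ 4"
    by (simp add: mq algebra_simps power2_eq_square power3_eq_cube power4_eq_xxxx)
  have G: "of_int ?G = (q^4 + 4 * q^3 + 2 * q\<^sup>2 + 4 * q + 1) * of_int l ^ 4"
    by (simp add: mq algebra_simps power2_eq_square power3_eq_cube power4_eq_xxxx)
  have "(\<beta> * of_int ?F)\<^sup>2 = of_int (?F * ?G)"
    using eq F G unfolding of_int_mult[of ?F ?G] by algebra
  then obtain z where z: "?F * ?G = z\<^sup>2" by (rule rat_square_eq_of_int)
  obtain \<sigma> w where s: "\<bar>\<sigma>\<bar> = 1" "?G = \<sigma> * w\<^sup>2"
    using product_square_imp_E2_square[OF cop z] by blast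
  have "(q^4 + 4 * q^3 + 2 * q\<^sup>2 + 4 * q + 1) * of_int l ^ 4 = of_int \<sigma> * (of_int w)\<^sup>2"
    unfolding G[symmetric] s(2) by simp
  then have "q^4 + 4 * q^3 + 2 * q\<^sup>2 + 4 * q + 1 = of_int \<sigma> * (of_int w / (of_int l)\<^sup>2)\<^sup>2"
    using l by (simp add: field_simps flip: power_mult)
  moreover have "(q\<^sup>2 + 1) * (q\<^sup>2 + 4 * q + 1) = q^4 + 4 * q^3 + 2 * q\<^sup>2 + 4 * q + 1" by algebra
  ultimately show ?thesis using quartic_E2_rat[of q \<sigma>] s(1) by metis
qed

theorem quadratic_field_points:
  fixes K :: "'a::field_char_0 set"
  assumes K: "quadratic_field K" and t: "t \<in> K" and y: "y \<in> K" "y\<^sup>2 = t^4 + 4 * t^3 + 2 * t\<^sup>2 + 1"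
    and z: "z \<in> K" "z\<^sup>2 = t^4 + 4 * t^3 + 2 * t\<^sup>2 + 4 * t + 1"
  shows "t = 0 \<or> t = -1"
proof (cases "t \<in> range of_rat")
  case True
  then obtain q where q: "t = of_rat q" by blast
  let ?f = "q^4 + 4 * q^3 + 2 * q\<^sup>2 + 1" and ?g = "q^4 + 4 * q^3 + 2 * q\<^sup>2 + 4 * q + 1"
  have yf: "y\<^sup>2 = of_rat ?f" and zg: "z\<^sup>2 = of_rat ?g"
    using y(2) z(2) unfolding q by (simp_all add: of_rat_add of_rat_mult of_rat_power)
  have "q = 0 \<or> q = -1"
  proof (cases "y \<in> range of_rat")
    case True
    then obtain Y where "y = of_rat Y" by blast
    with yf have "of_rat (Y\<^sup>2) = (of_rat ?f :: 'a)" by (simp add: of_rat_power)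
    then show ?thesis using quartic_E1_rat[of q Y] by (simp only: of_rat_eq_iff)
  next
    case False
    obtain \<alpha> \<beta> where ab: "z = of_rat \<alpha> + of_rat \<beta> * y"
      using quadratic_field_span[OF K y(1) False z(1)] .
    have "of_rat (\<alpha>\<^sup>2 + \<beta>\<^sup>2 * ?f - ?g) + of_rat (2 * \<alpha> * \<beta>) * y = 0"
      using zg unfolding of_rat_diff zg[symmetric] of_rat_add[of "\<alpha>\<^sup>2"] of_rat_mult[of "\<beta>\<^sup>2"] yf[symmetric] ab
      by (simp add: of_rat_mult of_rat_power algebra_simps power2_eq_square)
    from irrational_linear[OF False this]
    have "\<alpha>\<^sup>2 + \<beta>\<^sup>2 * ?f - ?g = 0" "2 * \<alpha> * \<beta> = 0" by blast+
    then have "\<alpha>\<^sup>2 + \<beta>\<^sup>2 * ?f = ?g" "\<alpha> = 0 \<or> \<beta> = 0" by (simp_all only: right_minus_eq mult_eq_0_iff) simp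
    then consider "?g = \<beta>\<^sup>2 * ?f" | "?g = \<alpha>\<^sup>2" by auto
    then show ?thesis
    proof cases
      case 1
      then show ?thesis by (rule rational_point)
    next
      case 2
      then have "(q\<^sup>2 + 1) * (q\<^sup>2 + 4 * q + 1) = of_int 1 * \<alpha>\<^sup>2"
        by (simp add: algebra_simps power2_eq_square power3_eq_cube power4_eq_xxxx)
      then show ?thesis using quartic_E2_rat[of q 1 \<alpha>] by auto
    qed
  qed
  then show ?thesis using q by (auto simp: of_rat_minus)
next
  case False
  have mult: "u * w \<in> K" if "u \<in> K" "w \<in> K" for u w
    using K that by (auto simp: quadratic_field_def subfield_set_def)
  obtain p1 p2 where p: "t * t = of_rat p1 + of_rat p2 * t" using quadratic_field_span[OF K t False mult[OF t t]] .
  define u v where "u = - p2" and "v = - p1"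
  have tq: "t\<^sup>2 + of_rat u * t + of_rat v = 0" using p by (simp add: u_def v_def of_rat_minus power2_eq_square)
  have "v \<noteq> 0"
  proof
    assume "v = 0"
    then have "t * (t - of_rat (- u)) = 0" using tq by (simp add: of_rat_minus power2_eq_square algebra_simps)
    then have "t = of_rat 0 \<or> t = of_rat (- u)" by auto
    with False show False by blast
  qed
  obtain \<alpha> \<beta> where ya: "y = of_rat \<alpha> + of_rat \<beta> * t" using quadratic_field_span[OF K t False y(1)] .
  obtain \<gamma> \<delta> where za: "z = of_rat \<gamma> + of_rat \<delta> * t" using quadratic_field_span[OF K t False z(1)] .
  have y0: "y\<^sup>2 = t^4 + 4 * t^3 + 2 * t\<^sup>2 + of_rat 0 * t + 1" using y(2) by simp
  have z4: "z\<^sup>2 = t^4 + 4 * t^3 + 2 * t\<^sup>2 + of_rat 4 * t + 1" using z(2) by simp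
  obtain a b d where "2 - a\<^sup>2 - 2 * b = d + (4 - 2 * a) * u" "0 - 2 * a * b = (4 - 2 * a) * v + d * u" "1 - b\<^sup>2 = d * v"
    using quadratic_point_on_quartic[OF False tq ya y0] .
  from quadratic_class_E1[OF quartic_E1_rat this]
  have "(v + 1) * u = 2 * v + 1 \<or> (v - 1) * u = v\<^sup>2" .
  moreover obtain a b d where "2 - a\<^sup>2 - 2 * b = d + (4 - 2 * a) * u" "4 - 2 * a * b = (4 - 2 * a) * v + d * u" "1 - b\<^sup>2 = d * v"
    using quadratic_point_on_quartic[OF False tq za z4] .
  from quadratic_class_E2[OF this]
  have "(v + 1) * u = 2 * v \<or> v = 1 \<and> (\<exists>w. 2 * (2 - w) * u = - (w\<^sup>2))" .
  ultimately show ?thesis using quadratic_classes_disjoint \<open>v \<noteq> 0\<close> by blast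
qed

lemma G1_points_on_curves:
  fixes a a' b b' p q r s c :: "'a::field_char_0"
  assumes eqs: "a\<^sup>2 + c = a" "b\<^sup>2 + c = a" "a'\<^sup>2 + c = a'" "b'\<^sup>2 + c = a'" "p\<^sup>2 + c = b" "q\<^sup>2 + c = b"
      "s\<^sup>2 + c = b'" "r\<^sup>2 + c = p"
    and ne: "b \<noteq> a" "b' \<noteq> a'" "a' \<noteq> a" "q \<noteq> p"
  defines "t \<equiv> a - 1 + p"
  shows "t \<noteq> 0" "t \<noteq> -1" "(2 * t * r)\<^sup>2 = t^4 + 4 * t^3 + 2 * t\<^sup>2 + 1"
    "(2 * t * s)\<^sup>2 = t^4 + 4 * t^3 + 2 * t\<^sup>2 + 4 * t + 1"
proof -
  have "b\<^sup>2 = a\<^sup>2" using eqs(1,2) by (metis add_right_cancel)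
  then have b: "b = - a" using ne(1) by (simp add: power2_eq_iff)
  have "b'\<^sup>2 = a'\<^sup>2" using eqs(3,4) by (metis add_right_cancel)
  then have b': "b' = - a'" using ne(2) by (simp add: power2_eq_iff)
  have "(a' - a) * (a' - (1 - a)) = (a'\<^sup>2 + c - a') - (a\<^sup>2 + c - a)"
    by (simp add: algebra_simps power2_eq_square)
  then have a': "a' = 1 - a" using ne(3) eqs(1,3) by simp
  have "q\<^sup>2 = p\<^sup>2" using eqs(5,6) by (metis add_right_cancel)
  then have "p \<noteq> 0" using ne(4) by auto
  have c: "c = a - a\<^sup>2" using eqs(1) by (simp add: algebra_simps)
  have tp: "t * (a - 1 - p) = 1" using eqs(5) unfolding b c t_def by algebra
  then show "t \<noteq> 0" by auto
  show "t \<noteq> -1"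
  proof
    assume "t = -1"
    then have "2 * p = 0" using tp unfolding t_def by algebra
    with \<open>p \<noteq> 0\<close> show False by simp
  qed
  show "(2 * t * r)\<^sup>2 = t^4 + 4 * t^3 + 2 * t\<^sup>2 + 1"
    using tp eqs(8) unfolding c t_def by algebra
  show "(2 * t * s)\<^sup>2 = t^4 + 4 * t^3 + 2 * t\<^sup>2 + 4 * t + 1"
    using tp eqs(7) unfolding b' a' c t_def by algebra
qed

theorem theorem5p2:
  fixes K :: "'a::field_char_0 set" and c :: 'a
  assumes "quadratic_field K" and "c \<in> K"
  shows "\<not> contains_isomorphic_subgraph (with_proj (preper_graph c K)) (with_proj G1)"
proof
  assume "contains_isomorphic_subgraph (with_proj (preper_graph c K)) (with_proj G1)"
  then obtain H where H: "subgraph H (with_proj (preper_graph c K))" "digraph_iso (with_proj G1) H"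
    by (auto simp: contains_isomorphic_subgraph_def)
  then obtain f where f: "pre_digraph.digraph_isomorphism (with_proj G1) f" "H = app_iso f (with_proj G1)"
    by (auto simp: digraph_iso_def)
  define h where "h = iso_verts f"
  have inj: "inj h" using f(1) by (simp add: pre_digraph.digraph_isomorphism_def h_def G1_def)
  have sub: "iso_tail f = fst" "iso_head f = snd" "iso_arcs f ` parcs G1 \<subseteq> parcs (preper_graph c K)"
      "h ` pverts G1 \<subseteq> pverts (preper_graph c K)"
    using H(1) unfolding f(2) subgraph_def compatible_def h_def by simp_all
  have hK: "h x \<in> K" for x
    using sub(4) by (auto simp: G1_def preper_graph_def Let_def)
  have arc: "(h x)\<^sup>2 + c = h y" if "(x, y) \<in> parcs G1" for x y
  proof -
    have "h x = fst (iso_arcs f (x, y))" "h y = snd (iso_arcs f (x, y))"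
      using f(1) that sub(1,2) unfolding pre_digraph.digraph_isomorphism_def h_def by (auto dest!: bspec[of _ _ "(x, y)"])
    moreover have "iso_arcs f (x, y) \<in> parcs (preper_graph c K)" using sub(3) that by blast
    ultimately show ?thesis by (auto simp: preper_graph_def Let_def quad_map_def)
  qed
  have eqs: "(h v_a)\<^sup>2 + c = h v_a" "(h v_b)\<^sup>2 + c = h v_a" "(h v_a')\<^sup>2 + c = h v_a'" "(h v_b')\<^sup>2 + c = h v_a'"
    "(h v_p)\<^sup>2 + c = h v_b" "(h v_pbar)\<^sup>2 + c = h v_b" "(h v_s)\<^sup>2 + c = h v_b'" "(h v_r)\<^sup>2 + c = h v_p"
    by (rule arc; simp add: G1_def)+
  have ne: "h v_b \<noteq> h v_a" "h v_b' \<noteq> h v_a'" "h v_a' \<noteq> h v_a" "h v_pbar \<noteq> h v_p"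
    using inj by (simp_all add: inj_eq)
  define t where "t = h v_a - 1 + h v_p"
  note t = G1_points_on_curves[OF eqs ne, folded t_def]
  have F: "subfield_set K" using assms(1) by (simp add: quadratic_field_def)
  then have one: "1 \<in> K" and diff: "\<And>x y. x \<in> K \<Longrightarrow> y \<in> K \<Longrightarrow> x - y \<in> K" and mult: "\<And>x y. x \<in> K \<Longrightarrow> y \<in> K \<Longrightarrow> x * y \<in> K"
    by (auto simp: subfield_set_def)
  have zero: "0 \<in> K" using diff[OF one one] by simp
  have add: "x + y \<in> K" if "x \<in> K" "y \<in> K" for x y using diff[OF that(1) diff[OF zero that(2)]] by simp
  have two: "2 \<in> K" using add[OF one one] by simp
  have tK: "t \<in> K" unfolding t_def by (intro add diff hK one)
  have "2 * t * h v_r \<in> K" "2 * t * h v_s \<in> K" by (intro mult two tK hK)+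
  from quadratic_field_points[OF assms(1) tK this(1) t(3) this(2) t(4)] t(1,2)
  show False by blast
qed

end
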